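(* Let $A$ be a commutative real C$^*$-algebra, let $V:A\times A\to\mathbb{R}$ be a continuous orthogonal form, let $B$ denote the complexification of $A$ and let $\widetilde V:B\times B\to\mathbb{C}$ be the (complex) bilinear extension of $V$. Then the form $\widetilde V$ is orthogonal if, and only if, there exists a functional $\varphi_1\in A^*$ such that $V(x,y)=\varphi_1(xy)$ for all $x,y\in A$.
   Context: A real C$^*$-algebra is a real Banach $*$-algebra $A$ satisfying $\|a^*a\|=\|a\|^2$ for all $a\in A$ and such that $1+a^*a$ is invertible in the unitization of $A$ for every $a\in A$. Its algebraic complexification $B=A\oplus iA$ carries a C$^*$-norm extending that of $A$ and is regarded as a complex C$^*$-algebra. $A^*$ is the space of bounded real-linear functionals $A\to\mathbb{R}$. In a real or complex C$^*$-algebra, $a\perp b$ means $ab^*=b^*a=0$; a bounded bilinear scalar-valued form $V$ on it is orthogonal if $V(a,b^* )=0$ whenever $a\perp b$. *)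

theory Defs
  imports Complex_Main
begin

class star =
  fixes star :: "'a \<Rightarrow> 'a"

subsection \<open>Real C*-algebras\<close>

text \<open>The algebras need not be unital. The unitization of \<open>A\<close> is \<open>A \<times> \<real>\<close>, the pair
  \<open>(a, s)\<close> standing for \<open>a + s1\<close>.\<close>

context real_algebra
begin

definition unitization_mult :: "'a \<times> real \<Rightarrow> 'a \<times> real \<Rightarrow> 'a \<times> real" where
  "unitization_mult u v =
     (fst u * fst v + snd u *\<^sub>R fst v + snd v *\<^sub>R fst u, snd u * snd v)"

definition unitization_one :: "'a \<times> real" where
  "unitization_one = (0, 1)"

definition unitization_invertible :: "'a \<times> real \<Rightarrow> bool" where
  "unitization_invertible u \<longleftrightarrow>
     (\<exists>v. unitization_mult u v = unitization_one \<and> unitization_mult v u = unitization_one)"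

end

class real_banach_star_algebra = real_normed_algebra + banach + star +
  assumes star_star: "star (star a) = a"
    and star_add: "star (a + b) = star a + star b"
    and star_scaleR: "star (r *\<^sub>R a) = r *\<^sub>R star a"
    and star_mult: "star (a * b) = star b * star a"

class real_cstar_algebra = real_banach_star_algebra +
  assumes cstar_identity: "norm (star a * a) = (norm a)\<^sup>2"
    and one_plus_star_mult_invertible: "unitization_invertible (star a * a, 1)"


subsection \<open>Complex C*-algebras\<close>

text \<open>The norm of a complex C*-algebra is kept as a separate argument \<open>N\<close>, so that an algebraic
  complexification can be equipped with its C*-norm afterwards.\<close>

class complex_star_algebra = ring + star +
  fixes scaleC :: "complex \<Rightarrow> 'a \<Rightarrow> 'a"  (infixr \<open>*\<^sub>C\<close> 75)
  assumes scaleC_add_right: "c *\<^sub>C (x + y) = c *\<^sub>C x + c *\<^sub>C y"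
    and scaleC_add_left: "(c + d) *\<^sub>C x = c *\<^sub>C x + d *\<^sub>C x"
    and scaleC_scaleC: "c *\<^sub>C d *\<^sub>C x = (c * d) *\<^sub>C x"
    and scaleC_one: "1 *\<^sub>C x = x"
    and mult_scaleC_left: "(c *\<^sub>C x) * y = c *\<^sub>C (x * y)"
    and mult_scaleC_right: "x * (c *\<^sub>C y) = c *\<^sub>C (x * y)"
    and cstar_star: "star (star x) = x"
    and cstar_add: "star (x + y) = star x + star y"
    and cstar_scaleC: "star (c *\<^sub>C x) = cnj c *\<^sub>C star x"
    and cstar_mult: "star (x * y) = star y * star x"

definition complex_cstar_norm :: "('b::complex_star_algebra \<Rightarrow> real) \<Rightarrow> bool" where
  "complex_cstar_norm N \<longleftrightarrow>
     (\<forall>x. N x \<ge> 0) \<and>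
     (\<forall>x. N x = 0 \<longleftrightarrow> x = 0) \<and>
     (\<forall>x y. N (x + y) \<le> N x + N y) \<and>
     (\<forall>c x. N (c *\<^sub>C x) = cmod c * N x) \<and>
     (\<forall>x y. N (x * y) \<le> N x * N y) \<and>
     (\<forall>x. N (star x * x) = (N x)\<^sup>2) \<and>
     (\<forall>X::nat \<Rightarrow> 'b. (\<forall>e>0. \<exists>M. \<forall>m\<ge>M. \<forall>n\<ge>M. N (X m - X n) < e) \<longrightarrow>
        (\<exists>L. (\<lambda>n. N (X n - L)) \<longlonglongrightarrow> 0))"


subsection \<open>The complexification of a real C*-algebra\<close>

text \<open>\<open>Complexification a b\<close> stands for \<open>a + ib\<close>.\<close>

datatype 'a complexification = Complexification (re_part: 'a) (im_part: 'a)

instantiation complexification :: (real_banach_star_algebra) complex_star_algebra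
begin

definition zero_complexification :: "'a complexification" where
  "0 = Complexification 0 0"

definition plus_complexification ::
    "'a complexification \<Rightarrow> 'a complexification \<Rightarrow> 'a complexification" where
  "x + y = Complexification (re_part x + re_part y) (im_part x + im_part y)"

definition uminus_complexification :: "'a complexification \<Rightarrow> 'a complexification" where
  "- x = Complexification (- re_part x) (- im_part x)"

definition minus_complexification ::
    "'a complexification \<Rightarrow> 'a complexification \<Rightarrow> 'a complexification" where
  "x - y = Complexification (re_part x - re_part y) (im_part x - im_part y)"

definition times_complexification ::
    "'a complexification \<Rightarrow> 'a complexification \<Rightarrow> 'a complexification" where
  "x * y = Complexification (re_part x * re_part y - im_part x * im_part y)
                            (re_part x * im_part y + im_part x * re_part y)"

definition scaleC_complexification ::
    "complex \<Rightarrow> 'a complexification \<Rightarrow> 'a complexification" where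
  "c *\<^sub>C x = Complexification (Re c *\<^sub>R re_part x - Im c *\<^sub>R im_part x)
                             (Re c *\<^sub>R im_part x + Im c *\<^sub>R re_part x)"

definition star_complexification :: "'a complexification \<Rightarrow> 'a complexification" where
  "star x = Complexification (star (re_part x)) (- star (im_part x))"

instance
proof -
  have star_minus: "star (- a) = - star a" for a :: 'a
    using star_scaleR[of "-1" a] by simp
  have star_diff: "star (a - b) = star a - star b" for a b :: 'a
    using star_add[of a "- b"] by (simp add: star_minus)
  show "OFCLASS('a complexification, complex_star_algebra_class)"
    by standard
      (auto simp: zero_complexification_def plus_complexification_def
        uminus_complexification_def minus_complexification_def times_complexification_def
        scaleC_complexification_def star_complexification_def star_star star_add star_scaleR
        star_mult star_minus star_diff algebra_simps)
qed

end

text \<open>The C*-norm of the complexification (it exists and is unique for every real C*-algebra).\<close>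

definition complexification_norm ::
    "('a::real_cstar_algebra complexification \<Rightarrow> real) \<Rightarrow> bool" where
  "complexification_norm N \<longleftrightarrow>
     complex_cstar_norm N \<and> (\<forall>a. N (Complexification a 0) = norm a)"

definition bilinear_extension ::
    "('a \<Rightarrow> 'a \<Rightarrow> real) \<Rightarrow> 'a complexification \<Rightarrow> 'a complexification \<Rightarrow> complex" where
  "bilinear_extension V x y =
     Complex (V (re_part x) (re_part y) - V (im_part x) (im_part y))
             (V (re_part x) (im_part y) + V (im_part x) (re_part y))"


subsection \<open>Orthogonal forms\<close>

definition orthogonal_elements :: "'a::{star, times, zero} \<Rightarrow> 'a \<Rightarrow> bool" where
  "orthogonal_elements a b \<longleftrightarrow> a * star b = 0 \<and> star b * a = 0"

definition real_orthogonal_form :: "('a::real_cstar_algebra \<Rightarrow> 'a \<Rightarrow> real) \<Rightarrow> bool" where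
  "real_orthogonal_form V \<longleftrightarrow>
     bounded_bilinear V \<and> (\<forall>a b. orthogonal_elements a b \<longrightarrow> V a (star b) = 0)"

definition bounded_complex_bilinear ::
    "('b::complex_star_algebra \<Rightarrow> real) \<Rightarrow> ('b \<Rightarrow> 'b \<Rightarrow> complex) \<Rightarrow> bool" where
  "bounded_complex_bilinear N W \<longleftrightarrow>
     (\<forall>x x' y. W (x + x') y = W x y + W x' y) \<and>
     (\<forall>x y y'. W x (y + y') = W x y + W x y') \<and>
     (\<forall>c x y. W (c *\<^sub>C x) y = c * W x y) \<and>
     (\<forall>c x y. W x (c *\<^sub>C y) = c * W x y) \<and>
     (\<exists>K. \<forall>x y. cmod (W x y) \<le> N x * N y * K)"

definition complex_orthogonal_form ::
    "('b::complex_star_algebra \<Rightarrow> real) \<Rightarrow> ('b \<Rightarrow> 'b \<Rightarrow> complex) \<Rightarrow> bool" where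
  "complex_orthogonal_form N W \<longleftrightarrow>
     bounded_complex_bilinear N W \<and> (\<forall>a b. orthogonal_elements a b \<longrightarrow> W a (star b) = 0)"

end

theory Submission
  imports Defs "HOL-Analysis.Analysis" "HOL-Computational_Algebra.Polynomial"
begin

text \<open>
  Let \<open>W\<close> be the bilinear extension of \<open>V\<close> to the complexification \<open>B\<close>. Since \<open>B\<close> is
  commutative, \<open>W\<close> is orthogonal exactly when it is bounded and \<open>W x z = 0\<close> whenever
  \<open>x * z = 0\<close>. With \<open>B = C\<^sub>0(X)\<close> in mind, such a form is carried by the diagonal of
  \<open>X \<times> X\<close>, so it should depend on the product \<open>x * z\<close> only. The argument below makes this
  precise without a representation of \<open>B\<close> as an algebra of functions.

  The tool is the following description of self-adjoint elements. If \<open>h\<close> is self-adjoint of norm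
  below 1, then \<open>p = 1 - sqrt (1 - h\<^sup>2)\<close> exists in \<open>B\<close> (\<open>cosine_partner_exists\<close>), and
  \<open>u = h + \<i>(1 - p)\<close> is unitary with \<open>h = (u + u*)/2\<close>. There need not be a unit in \<open>B\<close>, so
  \<open>u\<close> is treated as an isometric operator on \<open>B\<close>.

  Suppose that \<open>W\<close> is orthogonal. A polynomial in \<open>h\<close> of degree \<open>d\<close> is a Laurent
  polynomial in \<open>u\<close>, which bounds its norm by \<open>2 d + 1\<close> times its supremum on \<open>[-1, 1]\<close>;
  applying this bound to high powers and using the C*-identity removes the factor
  (\<open>N_poly_act_le_sup\<close>). Hence continuous functions on \<open>[-1, 1]\<close> act on \<open>B\<close>, and for fixed
  \<open>x\<close> and \<open>z\<close> the form \<open>w f g = W (f(h) x) (g(h) z)\<close> vanishes whenever \<open>f g = 0\<close>. Cutting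
  the identity function into \<open>n\<close> thin layers shows that \<open>w\<close> does not distinguish the
  pairs \<open>(t, 1)\<close> and \<open>(1, t)\<close> (\<open>local_bilinear_form_balanced\<close>), that is,
  \<open>W (h x) z = W x (h z)\<close>. As self-adjoint elements span \<open>B\<close>, the form is balanced, and letting
  \<open>u\<close> run through an approximate unit in \<open>W (u x) y = W u (x y)\<close> gives \<open>W x y = \<phi> (x y)\<close> with
  \<open>\<phi> z = lim W u z\<close> (\<open>representation\<close>). The real part of \<open>\<phi>\<close> restricted to \<open>A\<close> is the
  functional wanted.

  Conversely, if \<open>V x y = \<phi>\<^sub>1 (x y)\<close>, then \<open>W x y = \<Phi> (x y)\<close> for the complex-linear extension
  \<open>\<Phi>\<close> of \<open>\<phi>\<^sub>1\<close>, which makes \<open>W\<close> vanish on zero products. Boundedness needs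
  \<open>norm a \<le> N (a + \<i> b)\<close>, which follows once the conjugation \<open>a + \<i> b \<mapsto> a - \<i> b\<close> is contractive.
  It is so because conjugation preserves the algebraic relation between \<open>h\<close> and \<open>p\<close>, and that
  relation alone forces \<open>N h \<le> 1\<close> (\<open>cosine_partner_norm_le_1\<close>).
\<close>


section \<open>Complex C*-norms\<close>

lemma scaleC_zero_left [simp]: "0 *\<^sub>C x = (0::'b::complex_star_algebra)"
  using scaleC_add_left[of 0 0 x] by simp

lemma scaleC_zero_right [simp]: "c *\<^sub>C 0 = (0::'b::complex_star_algebra)"
  using scaleC_add_right[of c 0 "0::'b"] by simp

lemma scaleC_minus_left [simp]: "(- c) *\<^sub>C x = - (c *\<^sub>C (x::'b::complex_star_algebra))"
  using scaleC_add_left[of "- c" c x] by (simp add: eq_neg_iff_add_eq_0)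

lemma scaleC_minus_right [simp]: "c *\<^sub>C (- x) = - (c *\<^sub>C (x::'b::complex_star_algebra))"
  using scaleC_add_right[of c "- x" x] by (simp add: eq_neg_iff_add_eq_0)

lemma scaleC_diff_right: "c *\<^sub>C (x - y) = c *\<^sub>C x - c *\<^sub>C (y::'b::complex_star_algebra)"
  using scaleC_add_right[of c x "- y"] by simp

lemma scaleC_half: "(1/2) *\<^sub>C x + (1/2) *\<^sub>C x = (x::'b::complex_star_algebra)"
  by (simp add: scaleC_one flip: scaleC_add_left)

lemma cstar_minus [simp]: "star (- x) = - star (x::'b::complex_star_algebra)"
  using cstar_scaleC[of "-1" x] by (simp add: scaleC_one)

lemma cstar_diff: "star (x - y) = star x - star (y::'b::complex_star_algebra)"
  using cstar_add[of x "- y"] by simp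

lemma cstar_zero [simp]: "star 0 = (0::'b::complex_star_algebra)"
  using cstar_diff[of "0::'b" 0] by simp

lemmas scaleC_simps = scaleC_add_right scaleC_add_left scaleC_diff_right scaleC_scaleC scaleC_one
  mult_scaleC_left mult_scaleC_right
lemmas cstar_simps = cstar_star cstar_add cstar_diff cstar_scaleC cstar_mult

locale commutative_cstar =
  fixes N :: "'b::{complex_star_algebra, comm_ring} \<Rightarrow> real"
  assumes cstar_norm: "complex_cstar_norm N"
begin

lemma N_nonneg [simp]: "0 \<le> N x"
  and N_eq_0 [simp]: "N x = 0 \<longleftrightarrow> x = 0"
  and N_triangle: "N (x + y) \<le> N x + N y"
  and N_scaleC [simp]: "N (c *\<^sub>C x) = cmod c * N x"
  and N_mult: "N (x * y) \<le> N x * N y"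
  and N_star_mult: "N (star x * x) = (N x)\<^sup>2"
  using cstar_norm unfolding complex_cstar_norm_def by simp_all

lemma N_zero [simp]: "N 0 = 0"
  by simp

lemma N_complete:
  assumes "\<And>e. e > 0 \<Longrightarrow> \<exists>M. \<forall>m\<ge>M. \<forall>n\<ge>M. N (X m - X n) < e"
  obtains L where "(\<lambda>n::nat. N (X n - L)) \<longlonglongrightarrow> 0"
proof -
  have "\<forall>X::nat \<Rightarrow> 'b. (\<forall>e>0. \<exists>M. \<forall>m\<ge>M. \<forall>n\<ge>M. N (X m - X n) < e) \<longrightarrow>
      (\<exists>L. (\<lambda>n. N (X n - L)) \<longlonglongrightarrow> 0)"
    using cstar_norm unfolding complex_cstar_norm_def by (elim conjE)
  from this[rule_format, of X] assms that show ?thesis by metis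
qed

lemma N_minus [simp]: "N (- x) = N x"
  using N_scaleC[of "-1" x] by (simp add: scaleC_one)

lemma N_minus_commute: "N (x - y) = N (y - x)"
  using N_minus[of "x - y"] by simp

lemma N_triangle_diff: "N (x - y) \<le> N x + N y"
  using N_triangle[of x "- y"] by simp

lemma N_triangle_via: "N (x - z) \<le> N (x - y) + N (y - z)"
  using N_triangle[of "x - y" "y - z"] by simp

lemma N_le_if_diff_tendsto_0:
  assumes "(\<lambda>n::nat. N (X n - L)) \<longlonglongrightarrow> 0" "\<And>n. N (X n) \<le> c"
  shows "N L \<le> c"
proof (rule tendsto_le[OF sequentially_bot])
  show "(\<lambda>n. c + N (X n - L)) \<longlonglongrightarrow> c"
    using tendsto_add[OF tendsto_const[of c] assms(1)] by simp
  show "\<forall>\<^sub>F n in sequentially. N L \<le> c + N (X n - L)"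
  proof (intro always_eventually allI)
    fix n
    show "N L \<le> c + N (X n - L)"
      using N_triangle_diff[of "X n" "X n - L"] assms(2)[of n] by simp
  qed
qed simp

lemma N_star_le: "N x \<le> N (star x)"
proof (cases "x = 0")
  case False
  then have "0 < N x"
    by (simp add: less_le)
  moreover have "N x * N x \<le> N (star x) * N x"
    using N_mult[of "star x" x] by (simp add: N_star_mult power2_eq_square)
  ultimately show ?thesis by simp
qed simp

lemma N_star [simp]: "N (star x) = N x"
  using N_star_le[of x] N_star_le[of "star x"] by (simp add: cstar_star)

end


section \<open>Self-adjoint elements as cosines of unitaries\<close>

context commutative_cstar
begin

text \<open>The relation says \<open>h\<^sup>2 + (1 - p)\<^sup>2 = 1\<close>, written without the unit: if \<open>h\<close> is a cosine, then
  \<open>1 - p\<close> is the sine.\<close>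

definition cosine_partner :: "'b \<Rightarrow> 'b \<Rightarrow> bool" where
  "cosine_partner h p \<longleftrightarrow> star h = h \<and> star p = p \<and> p + p - p * p = h * h"

text \<open>The relation is the fixed-point equation \<open>p = (h\<^sup>2 + p\<^sup>2) / 2\<close>. Starting at 0, the iteration stays in
  the ball of radius \<open>r = N h\<close>, where the right-hand side is a contraction with factor \<open>r\<close>.\<close>

lemma cosine_partner_exists:
  assumes h: "star h = h" "N h < 1"
  obtains p where "cosine_partner h p"
proof -
  define r where "r = N h"
  have r: "0 \<le> r" "r < 1" using h by (auto simp: r_def)
  define P where "P = rec_nat 0 (\<lambda>_ p. (1/2) *\<^sub>C (h * h + p * p))"
  have P0: "P 0 = 0" and PS: "P (Suc n) = (1/2) *\<^sub>C (h * h + P n * P n)" for n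
    by (simp_all add: P_def)
  have starP: "star (P n) = P n" for n
    by (induction n) (simp_all add: P0 PS cstar_simps h)
  have NP: "N (P n) \<le> r" for n
  proof (induction n)
    case (Suc n)
    have "N (P (Suc n)) \<le> (1/2) * (N h * N h + N (P n) * N (P n))"
      using N_triangle[of "h * h" "P n * P n"] N_mult[of h h] N_mult[of "P n" "P n"]
      by (simp add: PS)
    also have "\<dots> \<le> (1/2) * (r * 1 + r * 1)"
      using Suc r by (intro mult_left_mono add_mono mult_mono) (auto simp: r_def)
    finally show ?case by simp
  qed (simp add: P0 r)
  have step: "N (P (Suc n) - P n) \<le> r ^ n" for n
  proof (induction n)
    case 0
    show ?case using NP[of 1] r by (simp add: P0)
  next
    case (Suc n)
    have "P (Suc (Suc n)) - P (Suc n) =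
        (1/2) *\<^sub>C (h * h + P (Suc n) * P (Suc n) - (h * h + P n * P n))"
      unfolding scaleC_diff_right PS[symmetric] ..
    also have "h * h + P (Suc n) * P (Suc n) - (h * h + P n * P n) =
        (P (Suc n) + P n) * (P (Suc n) - P n)"
      by (simp add: algebra_simps)
    finally have "P (Suc (Suc n)) - P (Suc n) =
        (1/2) *\<^sub>C ((P (Suc n) + P n) * (P (Suc n) - P n))" .
    then have "N (P (Suc (Suc n)) - P (Suc n)) \<le> (1/2) * ((N (P (Suc n)) + N (P n)) * N (P (Suc n) - P n))"
      using N_mult[of "P (Suc n) + P n" "P (Suc n) - P n"] N_triangle[of "P (Suc n)" "P n"]
        mult_right_mono[OF N_triangle[of "P (Suc n)" "P n"] N_nonneg[of "P (Suc n) - P n"]]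
      by simp
    also have "\<dots> \<le> (1/2) * ((r + r) * r ^ n)"
      using r NP Suc by (intro mult_left_mono mult_mono add_mono) auto
    finally show ?case by simp
  qed
  have "summable (\<lambda>n. r ^ n)"
    using r by (simp add: summable_geometric)
  have dist: "N (P m - P n) \<le> (\<Sum>k=n..<m. r ^ k)" if "n \<le> m" for m n
    using that
  proof (induction m rule: dec_induct)
    case (step m)
    then show ?case
      using N_triangle_via[of "P (Suc m)" "P n" "P m"] \<open>\<And>n. N (P (Suc n) - P n) \<le> r ^ n\<close>[of m] by simp
  qed simp
  obtain p where p: "(\<lambda>n. N (P n - p)) \<longlonglongrightarrow> 0"
  proof (rule N_complete)
    fix e :: real assume "e > 0"
    then obtain M where M: "\<And>m n. m \<ge> M \<Longrightarrow> norm (\<Sum>k=m..<n. r ^ k) < e"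
      using \<open>summable (\<lambda>n. r ^ n)\<close> unfolding summable_Cauchy by blast
    have "N (P m - P n) < e" if "m \<ge> M" "n \<ge> M" for m n
    proof (cases "n \<le> m")
      case True
      then show ?thesis using dist[of n m] M[of n m] that by auto
    next
      case False
      then show ?thesis using dist[of m n] M[of m n] that N_minus_commute[of "P m" "P n"] by auto
    qed
    then show "\<exists>M. \<forall>m\<ge>M. \<forall>n\<ge>M. N (P m - P n) < e" by blast
  qed
  have "N p \<le> r" using N_le_if_diff_tendsto_0[OF p NP] .
  have "star p = p"
  proof -
    have "N (star p - p) \<le> 2 * N (P n - p)" for n
      using N_triangle_via[of "star p" p "P n"] N_star[of "p - P n"] N_minus_commute[of p "P n"]
      by (simp add: cstar_simps starP)
    then have "N (star p - p) \<le> 0"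
      using LIMSEQ_le_const[OF tendsto_mult_right_zero[OF p, of 2], of "N (star p - p)"] by auto
    then show ?thesis
      using N_eq_0[of "star p - p"] N_nonneg[of "star p - p"] by (simp del: N_eq_0 N_nonneg)
  qed
  moreover have "p + p - p * p = h * h"
  proof -
    let ?d = "p + p - p * p - h * h"
    have "N ?d \<le> 2 * N (P (Suc n) - p) + 2 * r * N (P n - p)" for n
    proof -
      have "P (Suc n) + P (Suc n) = h * h + P n * P n"
        by (simp only: PS scaleC_half)
      then have "?d = (p - P (Suc n)) + (p - P (Suc n)) + (P n - p) * (P n + p)"
        by (simp add: algebra_simps)
      then have "N ?d = N ((p - P (Suc n)) + (p - P (Suc n)) + (P n - p) * (P n + p))"
        by (rule arg_cong)
      then have "N ?d \<le> N (p - P (Suc n)) + N (p - P (Suc n)) + N (P n - p) * N (P n + p)"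
        using N_triangle[of "(p - P (Suc n)) + (p - P (Suc n))" "(P n - p) * (P n + p)"]
          N_triangle[of "p - P (Suc n)" "p - P (Suc n)"] N_mult[of "P n - p" "P n + p"] by linarith
      moreover have "N (P n - p) * N (P n + p) \<le> N (P n - p) * (r + r)"
        using N_triangle[of "P n" p] NP[of n] \<open>N p \<le> r\<close> by (intro mult_left_mono) auto
      ultimately show ?thesis using N_minus_commute[of p "P (Suc n)"] by (simp add: algebra_simps)
    qed
    moreover have "(\<lambda>n. 2 * N (P (Suc n) - p) + 2 * r * N (P n - p)) \<longlonglongrightarrow> 0"
      using tendsto_add[OF tendsto_mult_right_zero[OF LIMSEQ_Suc[OF p], of 2]
        tendsto_mult_right_zero[OF p, of "2 * r"]] by simp
    ultimately have "N ?d \<le> 0"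
      by (intro LIMSEQ_le_const) auto
    then show ?thesis
      using N_eq_0[of ?d] N_nonneg[of ?d] by (simp del: N_eq_0 N_nonneg)
  qed
  ultimately show ?thesis using that h unfolding cosine_partner_def by blast
qed

text \<open>For \<open>c = \<i>\<close> this is multiplication by the unitary \<open>h + \<i>(1 - p)\<close> of the unitization, and for
  \<open>c = -\<i>\<close> multiplication by its adjoint.\<close>

definition rotation :: "complex \<Rightarrow> 'b \<Rightarrow> 'b \<Rightarrow> 'b \<Rightarrow> 'b" where
  "rotation c h p y = h * y + c *\<^sub>C (y - p * y)"

lemma rotation_inverse:
  assumes "cosine_partner h p" "c * c = -1"
  shows "rotation (- c) h p (rotation c h p y) = y"
proof -
  have "rotation (- c) h p (rotation c h p y) = h * h * y + (y - p * y - p * (y - p * y))"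
    using assms(2) by (simp add: rotation_def scaleC_simps algebra_simps)
  also have "h * h = p + p - p * p"
    using assms(1) by (simp add: cosine_partner_def)
  finally show ?thesis
    by (simp add: algebra_simps)
qed

lemma star_rotation:
  assumes "cosine_partner h p"
  shows "star (rotation c h p y) = rotation (cnj c) h p (star y)"
  using assms by (simp add: rotation_def cosine_partner_def cstar_simps mult.commute)

lemma rotation_mult: "rotation c h p x * y = rotation c h p (x * y)"
  by (simp add: rotation_def scaleC_simps algebra_simps)

lemma N_rotation:
  assumes "cosine_partner h p" "c * c = -1" "cnj c = - c"
  shows "N (rotation c h p y) = N y"
proof -
  have "star (rotation c h p y) * rotation c h p y = rotation (- c) h p (rotation c h p (y * star y))"
    by (simp add: star_rotation[OF assms(1)] assms(3) rotation_mult mult.commute[of "star y"])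
  also have "\<dots> = star y * y"
    by (simp add: rotation_inverse[OF assms(1,2)] mult.commute)
  finally have "(N (rotation c h p y))\<^sup>2 = (N y)\<^sup>2"
    by (simp flip: N_star_mult)
  then show ?thesis by simp
qed

lemma mult_eq_rotations: "h * y = (1/2) *\<^sub>C (rotation \<i> h p y + rotation (- \<i>) h p y)"
  by (simp add: rotation_def scaleC_half scaleC_add_right)

lemma mult_contraction:
  assumes "cosine_partner h p"
  shows "N (h * y) \<le> N y"
  using N_triangle[of "rotation \<i> h p y" "rotation (- \<i>) h p y"]
    N_rotation[OF assms, of \<i> y] N_rotation[OF assms, of "- \<i>" y]
  unfolding mult_eq_rotations[of h y p] by simp

text \<open>The relation is purely algebraic, so this estimate carries over along every map that preserves sums,
  products and adjoints, continuous or not.\<close>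

lemma cosine_partner_norm_le_1:
  assumes "cosine_partner h p"
  shows "N h \<le> 1"
proof (cases "h = 0")
  case False
  then have "0 < N h" by (simp add: less_le)
  moreover have "N h * N h \<le> N h * 1"
    using mult_contraction[OF assms, of h] N_star_mult[of h] assms
    by (simp add: cosine_partner_def power2_eq_square)
  ultimately show ?thesis by simp
qed simp

lemma cosine_partner_scaled:
  assumes "star h = h"
  obtains r p where "0 < r" "cosine_partner (of_real r *\<^sub>C h) p"
proof -
  let ?r = "1 / (N h + 1)"
  have r: "0 < ?r" using N_nonneg[of h] by (simp add: add_nonneg_pos)
  have "N (of_real ?r *\<^sub>C h) < 1"
    using r by (simp only: N_scaleC norm_of_real abs_of_pos) simp
  moreover have "star (of_real ?r *\<^sub>C h) = of_real ?r *\<^sub>C h"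
    by (simp only: cstar_scaleC complex_cnj_complex_of_real assms)
  ultimately obtain p where "cosine_partner (of_real ?r *\<^sub>C h) p"
    using cosine_partner_exists by metis
  with r show ?thesis by (rule that)
qed

lemma cosine_contraction:
  assumes "cosine_partner h p"
  shows "N (y - p * y) \<le> N y"
proof -
  have "\<i> *\<^sub>C (y - p * y) = (1/2) *\<^sub>C (rotation \<i> h p y - rotation (- \<i>) h p y)"
    by (simp add: rotation_def scaleC_half scaleC_add_right)
  then have "N (\<i> *\<^sub>C (y - p * y)) = (1/2) * N (rotation \<i> h p y - rotation (- \<i>) h p y)"
    by simp
  then show ?thesis
    using N_triangle_diff[of "rotation \<i> h p y" "rotation (- \<i>) h p y"]
      N_rotation[OF assms, of \<i> y] N_rotation[OF assms, of "- \<i>" y] by simp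
qed

end


section \<open>Polynomials in a self-adjoint element\<close>

definition complex_linear :: "('b::complex_star_algebra \<Rightarrow> 'b) \<Rightarrow> bool" where
  "complex_linear T \<longleftrightarrow> (\<forall>x y. T (x + y) = T x + T y) \<and> (\<forall>c x. T (c *\<^sub>C x) = c *\<^sub>C T x)"

lemma complex_linear_zero: "complex_linear T \<Longrightarrow> T 0 = 0"
  unfolding complex_linear_def by (metis scaleC_zero_left)

text \<open>Horner evaluation of a polynomial at a linear operator. Operators are used in place of elements because
  the algebra need not have a unit.\<close>

definition operator_poly :: "('b::complex_star_algebra \<Rightarrow> 'b) \<Rightarrow> complex poly \<Rightarrow> 'b \<Rightarrow> 'b" where
  "operator_poly T p = fold_coeffs (\<lambda>c f x. c *\<^sub>C x + T (f x)) p (\<lambda>_. 0)"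

lemma operator_poly_0 [simp]: "operator_poly T 0 x = 0"
  by (simp add: operator_poly_def)

lemma operator_poly_pCons [simp]:
  assumes "complex_linear T"
  shows "operator_poly T (pCons c p) x = c *\<^sub>C x + T (operator_poly T p x)"
  by (cases "c = 0 \<and> p = 0")
    (auto simp: operator_poly_def fold_coeffs_pCons_not_0_0_eq fold_coeffs_pCons_coeff_not_0_eq
      complex_linear_zero[OF assms])

lemma operator_poly_add:
  assumes T: "complex_linear T"
  shows "operator_poly T (p + q) x = operator_poly T p x + operator_poly T q x"
proof (induction p q rule: poly_induct2)
  case (pCons a p b q)
  then show ?case
    using T by (simp add: complex_linear_def scaleC_add_left algebra_simps)
qed simp

lemma operator_poly_smult:
  assumes T: "complex_linear T"
  shows "operator_poly T (smult a p) x = a *\<^sub>C operator_poly T p x"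
proof (induction p)
  case (pCons c p)
  then show ?case
    using T by (simp add: complex_linear_def scaleC_add_right scaleC_scaleC)
qed simp

lemma complex_linear_operator_poly:
  assumes T: "complex_linear T"
  shows "complex_linear (operator_poly T p)"
proof (induction p)
  case (pCons c p)
  then show ?case
    using T by (simp add: complex_linear_def scaleC_add_right scaleC_scaleC algebra_simps)
qed (simp add: complex_linear_def)

lemma operator_poly_mult:
  assumes T: "complex_linear T"
  shows "operator_poly T (p * q) x = operator_poly T p (operator_poly T q x)"
  by (induction p) (simp_all add: mult_pCons_left operator_poly_add[OF T] operator_poly_smult[OF T] T)

lemma operator_poly_diff:
  assumes T: "complex_linear T"
  shows "operator_poly T (p - q) x = operator_poly T p x - operator_poly T q x"
  using operator_poly_add[OF T, of "p - q" q x] by (simp add: algebra_simps)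

lemma operator_poly_monom:
  assumes T: "complex_linear T"
  shows "operator_poly T (monom c n) x = c *\<^sub>C (T ^^ n) x"
proof (induction n)
  case (Suc n)
  then show ?case
    using T by (simp add: monom_Suc complex_linear_def)
qed (simp add: monom_0 T complex_linear_zero)

text \<open>Averaging \<open>P(z) / z\<^sup>k\<close> over the roots of unity of an order above the degree isolates the
  coefficient.\<close>

lemma coeff_le_sup_circle:
  fixes P :: "complex poly"
  assumes bound: "\<And>z. cmod z = 1 \<Longrightarrow> cmod (poly P z) \<le> s"
  shows "cmod (coeff P k) \<le> s"
proof -
  define n where "n = Suc (degree P + k)"
  define \<omega> where "\<omega> j = exp (2 * of_real pi * \<i> * of_nat j / of_nat n)" for j :: nat
  have norm1: "cmod (\<omega> j) = 1" for j
    by (simp add: \<omega>_def)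
  have root: "\<omega> j ^ n = 1" for j
    using complex_root_unity[of n j] by (simp add: \<omega>_def n_def)
  have sum: "(\<Sum>j<n. (\<omega> i / \<omega> k) ^ j) = (if i = k then of_nat n else 0)" if "i \<le> degree P" for i
  proof (cases "i = k")
    case True
    then show ?thesis by (simp add: \<omega>_def)
  next
    case False
    then have "\<omega> i \<noteq> \<omega> k"
      using complex_root_unity_eq[of n i k] that by (simp add: \<omega>_def n_def)
    then have "\<omega> i / \<omega> k \<noteq> 1"
      using norm1[of k] by auto
    then show ?thesis
      using False by (subst geometric_sum) (simp_all add: power_divide root)
  qed
  have pow: "\<omega> j ^ i = \<omega> i ^ j" for i j
    unfolding \<omega>_def exp_of_nat_mult[symmetric] by (rule arg_cong[of _ _ exp]) simp
  have "(\<Sum>j<n. poly P (\<omega> j) / \<omega> k ^ j) = (\<Sum>j<n. \<Sum>i\<le>degree P. coeff P i * (\<omega> i / \<omega> k) ^ j)"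
    by (simp add: poly_altdef sum_divide_distrib power_divide pow)
  also have "\<dots> = (\<Sum>i\<le>degree P. coeff P i * (\<Sum>j<n. (\<omega> i / \<omega> k) ^ j))"
    by (subst sum.swap) (simp add: sum_distrib_left)
  also have "\<dots> = (\<Sum>i\<le>degree P. if i = k then coeff P k * of_nat n else 0)"
    by (intro sum.cong) (auto simp: sum)
  also have "\<dots> = coeff P k * of_nat n"
    by (simp add: coeff_eq_0)
  finally have "cmod (coeff P k) * n = cmod (\<Sum>j<n. poly P (\<omega> j) / \<omega> k ^ j)"
    by (simp add: norm_mult)
  also have "\<dots> \<le> (\<Sum>j<n. s)"
    using bound norm1 by (intro sum_norm_le) (simp add: norm_divide norm_power)
  finally show ?thesis
    by (simp add: n_def mult.commute)
qed

text \<open>If \<open>T\<close> is the mean of \<open>U\<close> and its inverse, then a polynomial in \<open>T\<close> is a Laurent polynomial in \<open>U\<close>; multiplying it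
  by a power of \<open>U\<close> turns it into a polynomial in \<open>U\<close>. Under the substitution
  \<open>z \<mapsto> (z + 1/z) / 2\<close> the unit circle is mapped to \<open>[-1, 1]\<close>.\<close>

lemma joukowski_poly:
  assumes U: "complex_linear U" and T: "complex_linear T"
    and UT: "\<And>y. U (T y) = (1/2) *\<^sub>C (U (U y) + y)"
  shows "\<exists>P. degree P \<le> 2 * degree p \<and>
    (\<forall>z. z \<noteq> 0 \<longrightarrow> poly P z = z ^ degree p * poly p ((z + 1 / z) / 2)) \<and>
    (\<forall>x. operator_poly U P x = (U ^^ degree p) (operator_poly T p x))"
proof (induction p)
  case 0
  show ?case by (rule exI[of _ 0]) auto
next
  case (pCons c p)
  show ?case
  proof (cases "p = 0")
    case True
    then show ?thesis
      by (intro exI[of _ "[:c:]"]) (auto simp: U T complex_linear_zero)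
  next
    case False
    define d where "d = degree p"
    obtain P where P: "degree P \<le> 2 * d"
      "\<And>z. z \<noteq> 0 \<Longrightarrow> poly P z = z ^ d * poly p ((z + 1 / z) / 2)"
      "\<And>x. operator_poly U P x = (U ^^ d) (operator_poly T p x)"
      using pCons.IH unfolding d_def by auto
    let ?Q = "monom c (Suc d) + [:1/2, 0, 1/2:] * P"
    have lin: "complex_linear (U ^^ n)" for n
      by (induction n) (use U in \<open>auto simp: complex_linear_def\<close>)
    have UTn: "(U ^^ Suc n) (T y) = (1/2) *\<^sub>C (U (U ((U ^^ n) y)) + (U ^^ n) y)" for n y
    proof (induction n)
      case (Suc n)
      then show ?case using U by (simp add: complex_linear_def)
    qed (simp add: UT)
    have "degree ?Q \<le> 2 * Suc d"
      using P(1) degree_mult_le[of "[:1/2, 0, 1/2:]" P]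
      by (intro degree_add_le order_trans[OF degree_monom_le]) auto
    moreover have "poly ?Q z = z ^ Suc d * poly (pCons c p) ((z + 1 / z) / 2)" if "z \<noteq> 0" for z
      using that P(2)[OF that] by (simp add: poly_monom field_simps power2_eq_square)
    moreover have "operator_poly U ?Q x = (U ^^ Suc d) (operator_poly T (pCons c p) x)" for x
    proof -
      have "operator_poly U ?Q x = c *\<^sub>C (U ^^ Suc d) x + (1/2) *\<^sub>C (U (U (operator_poly U P x)) + operator_poly U P x)"
        using U by (simp add: operator_poly_add operator_poly_mult operator_poly_monom operator_poly_smult
            complex_linear_zero)
          (simp add: complex_linear_def scaleC_add_right algebra_simps)
      also have "\<dots> = (U ^^ Suc d) (c *\<^sub>C x + T (operator_poly T p x))"
        using lin[of "Suc d"] by (simp only: P(3) UTn complex_linear_def)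
      finally show ?thesis using T by simp
    qed
    ultimately show ?thesis using False
      by (intro exI[of _ ?Q]) (auto simp: d_def)
  qed
qed

text \<open>A factor that grows linearly in the exponent is invisible to geometric growth.\<close>

lemma le_if_powers_le_linear:
  fixes a b :: real
  assumes "0 \<le> b" and le: "\<And>k. a ^ 2 ^ k \<le> (2 * 2 ^ k * real d + 1) * b ^ 2 ^ k"
  shows "a \<le> b"
proof (rule ccontr)
  assume "\<not> a \<le> b"
  show False
  proof (cases "b = 0")
    case True
    then show False using le[of 0] \<open>\<not> a \<le> b\<close> by simp
  next
    case False
    then have b: "0 < b" using assms(1) by simp
    define r where "r = sqrt (a / b) - 1"
    have r: "0 < r" using b \<open>\<not> a \<le> b\<close> by (simp add: r_def)
    define C where "C = (2 * real d + 1) / r\<^sup>2"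
    obtain k where k: "C < 2 ^ k"
      using real_arch_pow[of 2 C] by auto
    let ?m = "2 ^ k :: nat"
    have m: "(1::real) \<le> 2 ^ k" by simp
    have "?m * r \<le> (1 + r) ^ ?m"
      using Bernoulli_inequality[of r ?m] r by simp
    then have "(2 ^ k * r)\<^sup>2 \<le> ((1 + r) ^ ?m)\<^sup>2"
      using r by (intro power_mono) auto
    also have "\<dots> = ((1 + r)\<^sup>2) ^ ?m"
      by (simp flip: power_mult add: mult.commute)
    also have "\<dots> = (a / b) ^ ?m"
      using b \<open>\<not> a \<le> b\<close> by (simp add: r_def)
    also have "\<dots> \<le> 2 * 2 ^ k * real d + 1"
      using le[of k] b by (simp add: power_divide divide_simps)
    also have "\<dots> \<le> (2 * real d + 1) * 2 ^ k"
      using m by (simp add: algebra_simps)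
    finally have "2 ^ k * (2 ^ k * r\<^sup>2) \<le> 2 ^ k * (2 * real d + 1)"
      by (simp add: power2_eq_square algebra_simps)
    then have "2 ^ k * r\<^sup>2 \<le> 2 * real d + 1"
      by simp
    then have "2 ^ k \<le> C"
      using r by (simp add: C_def pos_le_divide_eq)
    then show False using k by simp
  qed
qed

context commutative_cstar
begin

lemma complex_linear_mult: "complex_linear ((*) (h::'b))"
  by (simp add: complex_linear_def algebra_simps mult_scaleC_right)

definition poly_act :: "'b \<Rightarrow> complex poly \<Rightarrow> 'b \<Rightarrow> 'b" where
  "poly_act h = operator_poly ((*) h)"

lemma poly_act_0 [simp]: "poly_act h 0 x = 0"
  and poly_act_pCons [simp]: "poly_act h (pCons c p) x = c *\<^sub>C x + h * poly_act h p x"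
  and poly_act_add: "poly_act h (p + q) x = poly_act h p x + poly_act h q x"
  and poly_act_smult: "poly_act h (smult a p) x = a *\<^sub>C poly_act h p x"
  and poly_act_diff: "poly_act h (p - q) x = poly_act h p x - poly_act h q x"
  and poly_act_mult: "poly_act h (p * q) x = poly_act h p (poly_act h q x)"
  by (simp_all add: poly_act_def complex_linear_mult operator_poly_add operator_poly_smult operator_poly_diff
      operator_poly_mult)

lemma complex_linear_poly_act: "complex_linear (poly_act h p)"
  by (simp add: poly_act_def complex_linear_operator_poly complex_linear_mult)

lemma complex_linear_rotation: "complex_linear (rotation c h p)"
  by (simp add: complex_linear_def rotation_def scaleC_simps algebra_simps)

lemma N_operator_poly_le_coeffs:
  assumes T: "complex_linear T" "\<And>y. N (T y) \<le> N y" and s: "\<And>k. cmod (coeff P k) \<le> s"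
  shows "N (operator_poly T P x) \<le> (real (degree P) + 1) * s * N x"
  using s
proof (induction P)
  case 0
  then show ?case by simp
next
  case (pCons c p)
  have c: "cmod c \<le> s" and p: "cmod (coeff p k) \<le> s" for k
    using pCons.prems[of 0] pCons.prems[of "Suc k"] by simp_all
  have "N (operator_poly T (pCons c p) x) \<le> cmod c * N x + N (operator_poly T p x)"
    using N_triangle[of "c *\<^sub>C x" "T (operator_poly T p x)"] T(2)[of "operator_poly T p x"] T(1) by simp
  also have "\<dots> \<le> s * N x + N (operator_poly T p x)"
    using c by (simp add: mult_right_mono)
  also have "\<dots> \<le> (real (degree (pCons c p)) + 1) * s * N x"
    using pCons.IH[OF p] by (cases "p = 0") (simp_all add: algebra_simps)
  finally show ?case .
qed

text \<open>On the unit circle, \<open>(z + 1/z) / 2 = Re z\<close>, so the Laurent polynomial is bounded there by the supremum of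
  \<open>p\<close> on \<open>[-1, 1]\<close>, and so is each of its at most \<open>2 d + 1\<close> coefficients. The unitary acts
  isometrically.\<close>

lemma N_poly_act_le_degree:
  assumes hp: "cosine_partner h q"
    and s: "\<And>t. \<bar>t\<bar> \<le> 1 \<Longrightarrow> cmod (poly p (of_real t)) \<le> s"
  shows "N (poly_act h p x) \<le> (2 * real (degree p) + 1) * s * N x"
proof -
  let ?U = "rotation \<i> h q" and ?d = "degree p"
  have UT: "?U (h * y) = (1/2) *\<^sub>C (?U (?U y) + y)" for y
    using complex_linear_rotation[of \<i> h q] rotation_inverse[OF hp, of "- \<i>" y]
    by (subst mult_eq_rotations[of h y q]) (simp add: complex_linear_def)
  obtain P where P: "degree P \<le> 2 * ?d"
    "\<And>z. z \<noteq> 0 \<Longrightarrow> poly P z = z ^ ?d * poly p ((z + 1 / z) / 2)"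
    "\<And>x. operator_poly ?U P x = (?U ^^ ?d) (poly_act h p x)"
    using joukowski_poly[OF complex_linear_rotation complex_linear_mult, of \<i> h q h p, OF UT]
    unfolding poly_act_def by blast
  have iso: "N (?U y) = N y" for y
    using N_rotation[OF hp] by simp
  have "N ((?U ^^ n) y) = N y" for n y
    by (induction n) (simp_all add: iso)
  then have "N (poly_act h p x) = N (operator_poly ?U P x)"
    by (simp add: P(3))
  also have "\<dots> \<le> (real (degree P) + 1) * s * N x"
  proof (rule N_operator_poly_le_coeffs[OF complex_linear_rotation])
    show "cmod (coeff P k) \<le> s" for k
    proof (rule coeff_le_sup_circle)
      fix z :: complex assume z: "cmod z = 1"
      then have "1 / z = cnj z"
        by (simp add: complex_div_cnj[of 1 z])
      then have "(z + 1 / z) / 2 = of_real (Re z)"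
        by (simp add: complex_add_cnj)
      moreover have "\<bar>Re z\<bar> \<le> 1"
        using z abs_Re_le_cmod[of z] by simp
      ultimately show "cmod (poly P z) \<le> s"
        using z P(2)[of z] s[of "Re z"] by (cases "z = 0") (auto simp: norm_mult norm_power)
    qed
  qed (simp add: iso)
  also have "\<dots> \<le> (2 * real ?d + 1) * s * N x"
  proof (intro mult_right_mono add_right_mono)
    show "0 \<le> s" using order_trans[OF norm_ge_zero s[of 0]] by simp
  qed (use P(1) in auto)
  finally show ?thesis .
qed

lemma poly_act_mult_left: "poly_act h p x * y = poly_act h p (x * y)"
  by (induction p) (simp_all add: mult_scaleC_left distrib_right mult.assoc)

lemma star_poly_act:
  assumes "star h = (h::'b)"
  shows "star (poly_act h p x) = poly_act h (map_poly cnj p) (star x)"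
  by (induction p)
    (simp_all add: map_poly_pCons cstar_simps assms mult.commute)

lemma N_poly_act_square:
  assumes "star h = h"
  shows "(N (poly_act h p x))\<^sup>2 \<le> N x * N (poly_act h (map_poly cnj p * p) x)"
proof -
  have "star (poly_act h p x) * poly_act h p x =
      poly_act h (map_poly cnj p) (poly_act h p x) * star x"
    by (simp add: star_poly_act[OF assms] poly_act_mult_left mult.commute[of "star x"])
  also have "\<dots> = star x * poly_act h (map_poly cnj p * p) x"
    by (simp add: poly_act_mult mult.commute[of "star x"])
  finally show ?thesis
    using N_mult[of "star x" "poly_act h (map_poly cnj p * p) x"]
    by (simp flip: N_star_mult)
qed

text \<open>Replacing \<open>p\<close> by \<open>p* p\<close> squares the norm of \<open>p(h)\<close> and the supremum of \<open>p\<close>, but only doubles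
  the degree. Iterating this \<open>k\<close> times, the factor \<open>2 d + 1\<close> of the crude bound is replaced by
  the \<open>2\<^sup>k\<close>-th root of \<open>2 \<cdot> 2\<^sup>k \<cdot> d + 1\<close>, which tends to 1.\<close>

lemma N_poly_act_le_sup:
  assumes hp: "cosine_partner h q"
    and s: "\<And>t. \<bar>t\<bar> \<le> 1 \<Longrightarrow> cmod (poly p (of_real t)) \<le> s"
  shows "N (poly_act h p x) \<le> s * N x"
proof -
  have h: "star h = h" using hp by (simp add: cosine_partner_def)
  have pow: "N (poly_act h p x) ^ 2 ^ k \<le>
      (2 * 2 ^ k * real (degree p) + 1) * (s * N x) ^ 2 ^ k"
    if "\<And>t. \<bar>t\<bar> \<le> 1 \<Longrightarrow> cmod (poly p (of_real t)) \<le> s" for p s k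
    using that
  proof (induction k arbitrary: p s)
    case 0
    show ?case using N_poly_act_le_degree[OF hp 0] by (simp add: mult.assoc)
  next
    case (Suc k)
    let ?r = "map_poly cnj p * p"
    have "N (poly_act h ?r x) ^ 2 ^ k \<le>
        (2 * 2 ^ k * real (degree ?r) + 1) * (s\<^sup>2 * N x) ^ 2 ^ k"
    proof (rule Suc.IH)
      fix t :: real assume "\<bar>t\<bar> \<le> 1"
      then have "cmod (poly p (of_real t)) * cmod (poly p (of_real t)) \<le> s * s"
        using Suc.prems[of t] by (intro mult_mono) (auto intro: order_trans[OF norm_ge_zero])
      then show "cmod (poly ?r (of_real t)) \<le> s\<^sup>2"
        by (simp add: norm_mult power2_eq_square)
    qed
    also have "\<dots> \<le> (2 * 2 ^ Suc k * real (degree p) + 1) * (s\<^sup>2 * N x) ^ 2 ^ k"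
    proof (intro mult_right_mono add_right_mono)
      have "degree ?r \<le> 2 * degree p"
        using degree_mult_le[of "map_poly cnj p" p] degree_map_poly[of cnj p] by simp
      then show "2 * 2 ^ k * real (degree ?r) \<le> 2 * 2 ^ Suc k * real (degree p)"
        by simp
    qed simp
    finally have r: "N (poly_act h ?r x) ^ 2 ^ k \<le>
        (2 * 2 ^ Suc k * real (degree p) + 1) * (s\<^sup>2 * N x) ^ 2 ^ k" .
    have "N (poly_act h p x) ^ 2 ^ Suc k = ((N (poly_act h p x))\<^sup>2) ^ 2 ^ k"
      by (simp flip: power_mult)
    also have "\<dots> \<le> (N x * N (poly_act h ?r x)) ^ 2 ^ k"
      using N_poly_act_square[OF h] by (intro power_mono) auto
    also have "\<dots> \<le> N x ^ 2 ^ k * ((2 * 2 ^ Suc k * real (degree p) + 1) * (s\<^sup>2 * N x) ^ 2 ^ k)"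
      using r by (simp add: power_mult_distrib mult_left_mono)
    also have "\<dots> = (2 * 2 ^ Suc k * real (degree p) + 1) * (s * N x) ^ 2 ^ Suc k"
      by (simp add: power_mult power2_eq_square power_mult_distrib mult_ac)
    finally show ?case .
  qed
  have "0 \<le> s"
    using order_trans[OF norm_ge_zero s[of 0]] by simp
  then show ?thesis
    using le_if_powers_le_linear[OF _ pow[OF s]] by simp
qed

end


section \<open>Continuous functions of a self-adjoint element\<close>

definition approximates :: "complex poly \<Rightarrow> real \<Rightarrow> (real \<Rightarrow> real) \<Rightarrow> bool" where
  "approximates q e f \<longleftrightarrow> (\<forall>t. \<bar>t\<bar> \<le> 1 \<longrightarrow> cmod (poly q (of_real t) - of_real (f t)) \<le> e)"

lemma approximatesD:
  "approximates q e f \<Longrightarrow> \<bar>t\<bar> \<le> 1 \<Longrightarrow> cmod (poly q (of_real t) - of_real (f t)) \<le> e"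
  by (simp add: approximates_def)

lemma approximates_mono: "approximates q d f \<Longrightarrow> d \<le> e \<Longrightarrow> approximates q e f"
  unfolding approximates_def using order_trans by blast

lemma approximates_exists:
  assumes "continuous_on {-1..1} f" "0 < e"
  obtains q where "approximates q e f"
proof -
  obtain g where g: "real_polynomial_function g" "\<And>t. t \<in> {-1..1} \<Longrightarrow> \<bar>f t - g t\<bar> < e"
    using Stone_Weierstrass_real_polynomial_function[OF _ assms] by (metis compact_Icc)
  obtain a n where a: "g = (\<lambda>t. \<Sum>i\<le>n. a i * t ^ i)"
    using g(1) real_polynomial_function_iff_sum by metis
  let ?q = "\<Sum>i\<le>n. monom (of_real (a i)) i :: complex poly"
  have "poly ?q (of_real t) = of_real (g t)" for t
    by (simp add: poly_sum poly_monom a)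
  moreover have "cmod (of_real (g t) - of_real (f t)) \<le> e" if "\<bar>t\<bar> \<le> 1" for t
  proof -
    have "cmod (of_real (g t) - of_real (f t)) = \<bar>f t - g t\<bar>"
      by (simp flip: of_real_diff add: abs_minus_commute)
    then show ?thesis using g(2)[of t] that by (auto simp: abs_le_iff)
  qed
  ultimately show ?thesis
    by (intro that[of ?q]) (simp add: approximates_def)
qed

lemma approximates_add:
  assumes "approximates q d f" "approximates r e g"
  shows "approximates (q + r) (d + e) (\<lambda>t. f t + g t)"
  unfolding approximates_def
proof (intro allI impI)
  fix t :: real assume t: "\<bar>t\<bar> \<le> 1"
  have "poly (q + r) (of_real t) - of_real (f t + g t) =
      (poly q (of_real t) - of_real (f t)) + (poly r (of_real t) - of_real (g t))"
    by simp
  then show "cmod (poly (q + r) (of_real t) - of_real (f t + g t)) \<le> d + e"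
    using norm_triangle_mono[OF approximatesD[OF assms(1) t] approximatesD[OF assms(2) t]]
    by (simp only:)
qed

lemma approximates_scale:
  assumes "approximates q e f"
  shows "approximates (smult (of_real c) q) (\<bar>c\<bar> * e) (\<lambda>t. c * f t)"
  unfolding approximates_def
proof (intro allI impI)
  fix t :: real assume t: "\<bar>t\<bar> \<le> 1"
  have "poly (smult (of_real c) q) (of_real t) - of_real (c * f t) =
      of_real c * (poly q (of_real t) - of_real (f t))"
    by (simp add: algebra_simps)
  then show "cmod (poly (smult (of_real c) q) (of_real t) - of_real (c * f t)) \<le> \<bar>c\<bar> * e"
    using mult_left_mono[OF approximatesD[OF assms t], of "\<bar>c\<bar>"] by (simp add: norm_mult)
qed

lemma approximates_bound:
  assumes "approximates q e f" "\<bar>t\<bar> \<le> 1" "\<bar>f t\<bar> \<le> b"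
  shows "cmod (poly q (of_real t)) \<le> b + e"
  using norm_triangle_sub[of "poly q (of_real t)" "of_real (f t)"] approximatesD[OF assms(1,2)] assms(3)
  by simp

context commutative_cstar
begin

lemma eq_0_if_N_arbitrarily_small:
  assumes "\<And>e. 0 < e \<Longrightarrow> e \<le> 1 \<Longrightarrow> N x \<le> e * K"
  shows "x = 0"
proof (rule ccontr)
  assume "x \<noteq> 0"
  then have x: "0 < N x" by (simp add: less_le)
  define e where "e = min 1 (N x / (2 * (\<bar>K\<bar> + 1)))"
  have e: "0 < e" "e \<le> 1" "e \<le> N x / (2 * (\<bar>K\<bar> + 1))" using x by (auto simp: e_def)
  have "N x \<le> e * (\<bar>K\<bar> + 1)"
    using assms[OF e(1,2)] mult_left_mono[of K "\<bar>K\<bar> + 1" e] e(1) by linarith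
  also have "\<dots> \<le> N x / (2 * (\<bar>K\<bar> + 1)) * (\<bar>K\<bar> + 1)"
    using e(3) by (intro mult_right_mono) auto
  also have "\<dots> = N x / 2" by (simp add: field_simps)
  finally show False using x by simp
qed

text \<open>The value \<open>f(h) x\<close> is pinned down by all polynomial approximations at once, with the error that a
  contractive calculus must have.\<close>

definition cont_act :: "'b \<Rightarrow> (real \<Rightarrow> real) \<Rightarrow> 'b \<Rightarrow> 'b" where
  "cont_act h f x = (THE L. \<forall>q e. approximates q e f \<longrightarrow> N (poly_act h q x - L) \<le> e * N x)"

text \<open>The sharp bound for polynomials makes the values of good approximations a Cauchy sequence.\<close>

lemma poly_act_close:
  assumes "cosine_partner h c" "approximates q d f" "approximates r e f"
  shows "N (poly_act h q x - poly_act h r x) \<le> (d + e) * N x"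
  unfolding poly_act_diff[symmetric]
proof (rule N_poly_act_le_sup[OF assms(1)])
  fix t :: real assume t: "\<bar>t\<bar> \<le> 1"
  have "poly (q - r) (of_real t) =
      (poly q (of_real t) - of_real (f t)) - (poly r (of_real t) - of_real (f t))"
    by simp
  then show "cmod (poly (q - r) (of_real t)) \<le> d + e"
    using norm_triangle_ineq4[of "poly q (of_real t) - of_real (f t)" "poly r (of_real t) - of_real (f t)"]
      approximatesD[OF assms(2) t] approximatesD[OF assms(3) t] by simp
qed

lemma cont_act_approx:
  assumes h: "cosine_partner h c" and f: "continuous_on {-1..1} f" and q: "approximates q e f"
  shows "N (poly_act h q x - cont_act h f x) \<le> e * N x"
proof -
  have "\<exists>!L. \<forall>q e. approximates q e f \<longrightarrow> N (poly_act h q x - L) \<le> e * N x"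
  proof (rule ex_ex1I)
    have "\<exists>q. approximates q (inverse (real (Suc n))) f" for n
      using approximates_exists[OF f, of "inverse (real (Suc n))"] 
      by (metis inverse_positive_iff_positive of_nat_0_less_iff zero_less_Suc)
    then obtain q where q: "\<And>n. approximates (q n) (inverse (real (Suc n))) f" by metis
    have small: "\<exists>M. \<forall>n\<ge>M. inverse (real (Suc n)) * N x < e" if "e > 0" for e
    proof -
      have "(\<lambda>n. inverse (real (Suc n)) * N x) \<longlonglongrightarrow> 0"
        using tendsto_mult_left_zero[OF LIMSEQ_inverse_real_of_nat] .
      from order_tendstoD(2)[OF this that] show ?thesis
        by (simp add: eventually_sequentially)
    qed
    obtain L where L: "(\<lambda>n. N (poly_act h (q n) x - L)) \<longlonglongrightarrow> 0"
    proof (rule N_complete)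
      fix e :: real assume "e > 0"
      then obtain M where M: "\<And>n. n \<ge> M \<Longrightarrow> inverse (real (Suc n)) * N x < e / 2"
        using small[of "e / 2"] by auto
      have "N (poly_act h (q m) x - poly_act h (q n) x) < e" if "m \<ge> M" "n \<ge> M" for m n
        using poly_act_close[OF h q[of m] q[of n], of x] M[OF that(1)] M[OF that(2)]
        unfolding distrib_right by linarith
      then show "\<exists>M. \<forall>m\<ge>M. \<forall>n\<ge>M. N (poly_act h (q m) x - poly_act h (q n) x) < e" by blast
    qed
    have "N (poly_act h r x - L) \<le> e * N x" if r: "approximates r e f" for r e
    proof (rule LIMSEQ_le_const)
      show "(\<lambda>n. (e + inverse (real (Suc n))) * N x + N (poly_act h (q n) x - L)) \<longlonglongrightarrow> e * N x"
        using tendsto_add[OF tendsto_mult_right[OF tendsto_add[OF tendsto_const[of e]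
            LIMSEQ_inverse_real_of_nat], of "N x"] L]
        by simp
      show "\<exists>M. \<forall>n\<ge>M. N (poly_act h r x - L) \<le> (e + inverse (real (Suc n))) * N x + N (poly_act h (q n) x - L)"
        using N_triangle_via[of "poly_act h r x" L] poly_act_close[OF h r q, of x]
        by (meson add_right_mono order_trans)
    qed
    then show "\<exists>L. \<forall>q e. approximates q e f \<longrightarrow> N (poly_act h q x - L) \<le> e * N x" by blast
  next
    fix L L'
    assume L: "\<forall>q e. approximates q e f \<longrightarrow> N (poly_act h q x - L) \<le> e * N x"
      and L': "\<forall>q e. approximates q e f \<longrightarrow> N (poly_act h q x - L') \<le> e * N x"
    have "L - L' = 0"
    proof (rule eq_0_if_N_arbitrarily_small)
      fix e :: real assume "0 < e"
      then obtain q where "approximates q e f" using approximates_exists[OF f] by metis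
      then show "N (L - L') \<le> e * (2 * N x)"
        using L L' N_triangle_via[of L L' "poly_act h q x"] N_minus_commute[of L "poly_act h q x"] by force
    qed
    then show "L = L'" by simp
  qed
  from theI'[OF this] q show ?thesis unfolding cont_act_def by blast
qed

lemma cont_act_eqI:
  assumes h: "cosine_partner h c" and f: "continuous_on {-1..1} f"
    and L: "\<And>e. 0 < e \<Longrightarrow> e \<le> 1 \<Longrightarrow> \<exists>q. approximates q (e * K) f \<and> N (poly_act h q x - L) \<le> e * K"
  shows "cont_act h f x = L"
proof -
  have "cont_act h f x - L = 0"
  proof (rule eq_0_if_N_arbitrarily_small)
    fix e :: real assume "0 < e" "e \<le> 1"
    from L[OF this] obtain q where q: "approximates q (e * K) f" "N (poly_act h q x - L) \<le> e * K"
      by auto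
    then show "N (cont_act h f x - L) \<le> e * (K * N x + K)"
      using N_triangle_via[of "cont_act h f x" L "poly_act h q x"]
        cont_act_approx[OF h f q(1), of x] N_minus_commute[of "cont_act h f x" "poly_act h q x"]
      by (simp add: algebra_simps)
  qed
  then show ?thesis by simp
qed

lemma cont_act_poly:
  assumes h: "cosine_partner h c" and f: "continuous_on {-1..1} f"
    and q: "\<And>t. poly q (of_real t) = of_real (f t)"
  shows "cont_act h f x = poly_act h q x"
  using cont_act_approx[OF h f, of q 0 x] N_nonneg[of "poly_act h q x - cont_act h f x"]
  by (simp add: approximates_def q del: N_nonneg)

lemma cont_act_add:
  assumes h: "cosine_partner h c" and f: "continuous_on {-1..1} f" and g: "continuous_on {-1..1} g"
  shows "cont_act h (\<lambda>t. f t + g t) x = cont_act h f x + cont_act h g x"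
proof (rule cont_act_eqI[OF h continuous_on_add[OF f g]])
  fix e :: real assume e: "0 < e"
  obtain q r where q: "approximates q e f" and r: "approximates r e g"
    using approximates_exists[OF f e] approximates_exists[OF g e] by metis
  let ?K = "2 * (N x + 1)"
  have "approximates (q + r) (e * ?K) (\<lambda>t. f t + g t)"
    using e by (intro approximates_mono[OF approximates_add[OF q r]]) (simp add: algebra_simps)
  moreover have "N (poly_act h (q + r) x - (cont_act h f x + cont_act h g x)) \<le> e * ?K"
    using N_triangle[of "poly_act h q x - cont_act h f x" "poly_act h r x - cont_act h g x"]
      cont_act_approx[OF h f q, of x] cont_act_approx[OF h g r, of x] e
    by (simp add: poly_act_add algebra_simps)
  ultimately show "\<exists>q. approximates q (e * ?K) (\<lambda>t. f t + g t) \<and>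
      N (poly_act h q x - (cont_act h f x + cont_act h g x)) \<le> e * ?K" by blast
qed

lemma cont_act_scale:
  assumes h: "cosine_partner h c" and f: "continuous_on {-1..1} f"
  shows "cont_act h (\<lambda>t. a * f t) x = of_real a *\<^sub>C cont_act h f x"
proof (rule cont_act_eqI[OF h continuous_on_mult_left[OF f]])
  fix e :: real assume e: "0 < e"
  obtain q where q: "approximates q e f"
    using approximates_exists[OF f e] by metis
  let ?K = "\<bar>a\<bar> * (N x + 1)"
  have "approximates (smult (of_real a) q) (e * ?K) (\<lambda>t. a * f t)"
    using e by (intro approximates_mono[OF approximates_scale[OF q]]) (simp add: algebra_simps)
  moreover have "N (poly_act h (smult (of_real a) q) x - of_real a *\<^sub>C cont_act h f x) \<le> e * ?K"
  proof -
    have "N (poly_act h (smult (of_real a) q) x - of_real a *\<^sub>C cont_act h f x) =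
        \<bar>a\<bar> * N (poly_act h q x - cont_act h f x)"
      by (simp add: poly_act_smult flip: scaleC_diff_right)
    also have "\<dots> \<le> \<bar>a\<bar> * (e * N x)"
      using cont_act_approx[OF h f q] by (rule mult_left_mono) simp
    also have "\<dots> \<le> e * ?K"
      using e by (simp add: algebra_simps)
    finally show ?thesis .
  qed
  ultimately show "\<exists>q. approximates q (e * ?K) (\<lambda>t. a * f t) \<and>
      N (poly_act h q x - of_real a *\<^sub>C cont_act h f x) \<le> e * ?K" by blast
qed

lemma N_cont_act_le:
  assumes h: "cosine_partner h c" and f: "continuous_on {-1..1} f"
    and b: "\<And>t. \<bar>t\<bar> \<le> 1 \<Longrightarrow> \<bar>f t\<bar> \<le> b"
  shows "N (cont_act h f x) \<le> b * N x"
proof (rule field_le_epsilon)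
  fix e :: real assume e: "0 < e"
  define d where "d = e / (2 * (N x + 1))"
  have d: "0 < d" using e N_nonneg[of x] by (simp add: d_def add_nonneg_pos)
  obtain q where q: "approximates q d f"
    using approximates_exists[OF f d] by metis
  have "N (poly_act h q x) \<le> (b + d) * N x"
    using approximates_bound[OF q _ b] by (intro N_poly_act_le_sup[OF h]) auto
  moreover have "N (poly_act h q x - cont_act h f x) \<le> d * N x"
    by (rule cont_act_approx[OF h f q])
  ultimately have "N (cont_act h f x) \<le> b * N x + 2 * d * N x"
    using N_triangle_diff[of "poly_act h q x" "poly_act h q x - cont_act h f x"]
    by (simp add: algebra_simps)
  also have "2 * d * N x \<le> 2 * d * (N x + 1)"
    using d by simp
  also have "2 * d * (N x + 1) = e"
    using add_nonneg_pos[OF N_nonneg[of x] zero_less_one] by (simp add: d_def field_simps)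
  finally show "N (cont_act h f x) \<le> b * N x + e" by simp
qed

text \<open>With polynomials \<open>q\<close> and \<open>r\<close> close to \<open>f\<close> and \<open>g\<close>, the product \<open>q(h) x * r(h) z\<close> is
  \<open>(q r)(h) (x z)\<close>, and \<open>q r\<close> is close to \<open>f g = 0\<close>.\<close>

lemma cont_act_mult_eq_0:
  assumes h: "cosine_partner h c" and f: "continuous_on {-1..1} f" and g: "continuous_on {-1..1} g"
    and fg: "\<And>t. \<bar>t\<bar> \<le> 1 \<Longrightarrow> f t * g t = 0"
  shows "cont_act h f x * cont_act h g z = 0"
proof -
  have "\<exists>b. \<forall>t. \<bar>t\<bar> \<le> 1 \<longrightarrow> \<bar>f' t\<bar> \<le> b" if "continuous_on {-1..1} f'" for f' :: "real \<Rightarrow> real"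
  proof -
    have "bounded (f' ` {-1..1})"
      using that by (intro compact_imp_bounded compact_continuous_image) auto
    then show ?thesis unfolding bounded_iff by (force simp: abs_le_iff)
  qed
  from this[OF f] this[OF g] obtain b1 b2 where
    b12: "\<And>t. \<bar>t\<bar> \<le> 1 \<Longrightarrow> \<bar>f t\<bar> \<le> b1" "\<And>t. \<bar>t\<bar> \<le> 1 \<Longrightarrow> \<bar>g t\<bar> \<le> b2" by blast
  define b where "b = max b1 b2"
  have bf: "\<bar>f t\<bar> \<le> b" and bg: "\<bar>g t\<bar> \<le> b" if "\<bar>t\<bar> \<le> 1" for t
    using b12[OF that] by (auto simp: b_def)
  have b: "0 \<le> b" using bf[of 0] by simp
  show ?thesis
  proof (rule eq_0_if_N_arbitrarily_small)
    fix e :: real assume e: "0 < e" "e \<le> 1"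
    obtain q r where q: "approximates q e f" and r: "approximates r e g"
      using approximates_exists[OF f e(1)] approximates_exists[OF g e(1)] by metis
    let ?F = "cont_act h f x" and ?G = "cont_act h g z"
    let ?Q = "poly_act h q x" and ?R = "poly_act h r z"
    have "?Q * ?R = poly_act h (q * r) (x * z)"
      by (simp add: poly_act_mult_left poly_act_mult mult.commute[of x])
    moreover have "N (poly_act h (q * r) (x * z)) \<le> (e * (2 * b + 1)) * N (x * z)"
    proof (rule N_poly_act_le_sup[OF h])
      fix t :: real assume t: "\<bar>t\<bar> \<le> 1"
      let ?a = "poly q (of_real t) - of_real (f t)" and ?c = "poly r (of_real t) - of_real (g t)"
      have "complex_of_real (f t) * of_real (g t) = 0"
        using fg[OF t] by (simp flip: of_real_mult)
      then have "poly (q * r) (of_real t) = ?a * poly r (of_real t) + of_real (f t) * ?c"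
        by (simp add: algebra_simps)
      then have "cmod (poly (q * r) (of_real t)) \<le> cmod ?a * cmod (poly r (of_real t)) + \<bar>f t\<bar> * cmod ?c"
        using norm_triangle_ineq[of "?a * poly r (of_real t)" "of_real (f t) * ?c"]
        by (simp add: norm_mult)
      also have "\<dots> \<le> e * (b + 1) + b * e"
        using approximatesD[OF q t] approximatesD[OF r t] approximates_bound[OF r t bg[OF t]]
          bf[OF t] e b
        by (intro add_mono mult_mono) auto
      also have "\<dots> = e * (2 * b + 1)" by (simp add: algebra_simps)
      finally show "cmod (poly (q * r) (of_real t)) \<le> e * (2 * b + 1)" .
    qed
    ultimately have QR: "N (?Q * ?R) \<le> e * ((2 * b + 1) * N (x * z))" by (simp add: mult.assoc)
    have Q: "N ?Q \<le> (b + 1) * N x"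
      using approximates_bound[OF q _ bf] e
      by (intro N_poly_act_le_sup[OF h]) (meson add_left_mono order_trans)
    have "?F * ?G = (?F - ?Q) * ?G + ?Q * (?G - ?R) + ?Q * ?R"
      by (simp add: algebra_simps)
    then have "N (?F * ?G) \<le> N ((?F - ?Q) * ?G) + N (?Q * (?G - ?R)) + N (?Q * ?R)"
      using N_triangle[of "(?F - ?Q) * ?G + ?Q * (?G - ?R)" "?Q * ?R"]
        N_triangle[of "(?F - ?Q) * ?G" "?Q * (?G - ?R)"] by simp
    also have "\<dots> \<le> (e * N x) * (b * N z) + ((b + 1) * N x) * (e * N z) + e * ((2 * b + 1) * N (x * z))"
    proof (intro add_mono QR)
      show "N ((?F - ?Q) * ?G) \<le> (e * N x) * (b * N z)"
        using cont_act_approx[OF h f q, of x] N_cont_act_le[OF h g bg, of z] e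
        by (intro order_trans[OF N_mult] mult_mono) (auto simp: N_minus_commute[of ?F])
      show "N (?Q * (?G - ?R)) \<le> ((b + 1) * N x) * (e * N z)"
        using cont_act_approx[OF h g r, of z] Q b
        by (intro order_trans[OF N_mult] mult_mono) (auto simp: N_minus_commute[of ?G])
    qed
    also have "\<dots> = e * (N x * (b * N z) + (b + 1) * N x * N z + (2 * b + 1) * N (x * z))"
      by (simp add: algebra_simps)
    finally show "N (?F * ?G) \<le> e * (N x * (b * N z) + (b + 1) * N x * N z + (2 * b + 1) * N (x * z))" .
  qed
qed

end


section \<open>Bilinear forms on continuous functions carried by the diagonal\<close>

text \<open>For \<open>s \<ge> 0\<close>, the length of the part of \<open>[0, s]\<close> that lies in \<open>[i, i + 1]\<close>.\<close>

definition ramp :: "nat \<Rightarrow> real \<Rightarrow> real" where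
  "ramp i s = max 0 (min 1 (s - real i))"

lemma sum_ramp: "0 \<le> s \<Longrightarrow> s \<le> real m \<Longrightarrow> (\<Sum>i<m. ramp i s) = s"
proof -
  have "(\<Sum>i<m. ramp i s) = max 0 (min (real m) s)" if "0 \<le> s"
    using that by (induction m) (auto simp: ramp_def max_def min_def)
  then show "0 \<le> s \<Longrightarrow> s \<le> real m \<Longrightarrow> (\<Sum>i<m. ramp i s) = s" by simp
qed

lemma ramp_bounds: "0 \<le> ramp i s" "ramp i s \<le> 1"
  by (auto simp: ramp_def)

lemma ramp_antimono: "i \<le> j \<Longrightarrow> ramp j s \<le> ramp i s"
  by (auto simp: ramp_def max_def min_def)

definition tent :: "nat \<Rightarrow> real \<Rightarrow> real" where
  "tent i s = ramp i s - ramp (Suc i) s"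

lemma ramp_Suc_mult: "i < j \<Longrightarrow> ramp j s * (1 - ramp i s) = 0"
  by (auto simp: ramp_def max_def min_def)

lemma tent_ramp_mult: "Suc i < j \<Longrightarrow> tent i s * ramp j s = 0"
  by (auto simp: tent_def ramp_def max_def min_def)

lemma tent_mult: "Suc i < j \<Longrightarrow> tent i s * tent j s = 0"
  using tent_ramp_mult[of i j s] tent_ramp_mult[of i "Suc j" s]
  unfolding tent_def[of j] right_diff_distrib by (simp only: diff_self)

text \<open>A tent is at most the drop from its ramp to the third next one, and along a residue class modulo 3 these
  drops telescope.\<close>

lemma sum_tent_le_1: "\<bar>\<Sum>j<l. tent (3 * j + r) s\<bar> \<le> 1"
proof -
  have "(\<Sum>j<l. tent (3 * j + r) s) \<le> ramp r s - ramp (3 * l + r) s"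
  proof (induction l)
    case (Suc l)
    then show ?case
      using ramp_antimono[of "Suc (3 * l + r)" "3 * Suc l + r" s] by (simp add: tent_def)
  qed simp
  moreover have "0 \<le> (\<Sum>j<l. tent (3 * j + r) s)"
    by (intro sum_nonneg) (simp add: tent_def ramp_antimono)
  ultimately show ?thesis
    using ramp_bounds[of r s] ramp_bounds[of "3 * l + r" s] by linarith
qed

lemma sum_lessThan_3_mult:
  fixes a :: "nat \<Rightarrow> 'a::comm_monoid_add"
  shows "(\<Sum>i<3 * l. a i) = (\<Sum>r<3. \<Sum>j<l. a (3 * j + r))"
  by (induction l) (simp_all add: numeral_3_eq_3 ac_simps)

text \<open>Put \<open>E f = w f 1 - w 1 f\<close> and rescale the identity to run from 1 to \<open>6 n + 1\<close>. Up to the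
  constant 1, where \<open>E\<close> vanishes, it is the sum of \<open>6 n\<close> ramps. A ramp is supported where its
  predecessor is 1, so locality turns \<open>E\<close> of a ramp into an expression in two neighbouring tents. In
  each residue class modulo 3, locality lets these expressions be added up into a single value of \<open>w\<close> at
  functions bounded by 1. So the total is at most \<open>6 K\<close> for all \<open>n\<close>, while it equals
  \<open>3 n\<close> times \<open>E\<close> of the identity.\<close>

lemma local_bilinear_form_balanced:
  fixes w :: "(real \<Rightarrow> real) \<Rightarrow> (real \<Rightarrow> real) \<Rightarrow> complex"
  defines "C \<equiv> continuous_on {-1..1}"
  assumes add_left: "\<And>f g k. C f \<Longrightarrow> C g \<Longrightarrow> C k \<Longrightarrow> w (\<lambda>t. f t + g t) k = w f k + w g k"
    and add_right: "\<And>f g k. C f \<Longrightarrow> C g \<Longrightarrow> C k \<Longrightarrow> w k (\<lambda>t. f t + g t) = w k f + w k g"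
    and scale_left: "\<And>c f k. C f \<Longrightarrow> C k \<Longrightarrow> w (\<lambda>t. c * f t) k = of_real c * w f k"
    and scale_right: "\<And>c f k. C f \<Longrightarrow> C k \<Longrightarrow> w k (\<lambda>t. c * f t) = of_real c * w k f"
    and bound: "\<And>f g. C f \<Longrightarrow> C g \<Longrightarrow> (\<And>t. \<bar>t\<bar> \<le> 1 \<Longrightarrow> \<bar>f t\<bar> \<le> 1) \<Longrightarrow>
      (\<And>t. \<bar>t\<bar> \<le> 1 \<Longrightarrow> \<bar>g t\<bar> \<le> 1) \<Longrightarrow> cmod (w f g) \<le> K"
    and local: "\<And>f g. C f \<Longrightarrow> C g \<Longrightarrow> (\<And>t. \<bar>t\<bar> \<le> 1 \<Longrightarrow> f t * g t = 0) \<Longrightarrow> w f g = 0"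
  shows "w (\<lambda>t. t) (\<lambda>_. 1) = w (\<lambda>_. 1) (\<lambda>t. t)"
proof -
  have C_diff: "C (\<lambda>t. f t - g t)" and C_add: "C (\<lambda>t. f t + g t)" if "C f" "C g" for f g
    using that by (auto simp: C_def intro: continuous_intros)
  have C_const [simp]: "C (\<lambda>_. c)" and C_id [simp]: "C (\<lambda>t. t)" for c
    by (auto simp: C_def)
  have C_sum: "C (\<lambda>t. \<Sum>i\<in>I. f i t)" if "\<And>i. C (f i)" for f :: "nat \<Rightarrow> _" and I
    using that by (auto simp: C_def intro: continuous_intros)
  have C_ramp [simp]: "C (\<lambda>t. ramp i (1 + c * (t + 1)))" for i c
    by (auto simp: C_def ramp_def intro!: continuous_intros)
  have C_tent [simp]: "C (\<lambda>t. tent i (1 + c * (t + 1)))" for i c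
    by (simp add: tent_def C_diff)
  have zero_left: "w (\<lambda>_. 0) k = 0" and zero_right: "w k (\<lambda>_. 0) = 0" if "C k" for k
    using that by (auto intro: local)
  have diff_left: "w (\<lambda>t. f t - g t) k = w f k - w g k" if "C f" "C g" "C k" for f g k
    using add_left[OF C_diff[OF that(1,2)] that(2,3)] by simp
  have diff_right: "w k (\<lambda>t. f t - g t) = w k f - w k g" if "C f" "C g" "C k" for f g k
    using add_right[OF C_diff[OF that(1,2)] that(2,3)] by simp
  have sum_left: "w (\<lambda>t. \<Sum>i<n. f i t) k = (\<Sum>i<n. w (f i) k)" if "\<And>i. C (f i)" "C k"
    for f k and n :: nat
    by (induction n) (simp_all add: zero_left add_left C_sum that)
  have sum_right: "w k (\<lambda>t. \<Sum>i<n. f i t) = (\<Sum>i<n. w k (f i))" if "\<And>i. C (f i)" "C k"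
    for f k and n :: nat
    by (induction n) (simp_all add: zero_right add_right C_sum that)
  have cong_left: "w f k = w g k" if "C f" "C g" "C k" "\<And>t. \<bar>t\<bar> \<le> 1 \<Longrightarrow> f t = g t" for f g k
    using local[of "\<lambda>t. f t - g t" k] diff_left[of f g k] that by (simp add: C_diff)
  have cong_right: "w k f = w k g" if "C f" "C g" "C k" "\<And>t. \<bar>t\<bar> \<le> 1 \<Longrightarrow> f t = g t" for f g k
    using local[of k "\<lambda>t. f t - g t"] diff_right[of f g k] that by (simp add: C_diff)
  define E where "E f = w f (\<lambda>_. 1) - w (\<lambda>_. 1) f" for f
  have const: "w (\<lambda>_. c) (\<lambda>_. 1) = w (\<lambda>_. 1) (\<lambda>_. c)" for c
    using scale_left[of "\<lambda>_. 1" "\<lambda>_. 1" c] scale_right[of "\<lambda>_. 1" "\<lambda>_. 1" c] by simp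
  have E_id: "real (3 * n) * cmod (E (\<lambda>t. t)) \<le> 6 * K" for n :: nat
  proof -
    define \<rho> where "\<rho> i t = ramp i (1 + real (3 * n) * (t + 1))" for i t
    define \<tau> where "\<tau> i t = tent i (1 + real (3 * n) * (t + 1))" for i t
    have C\<rho>: "C (\<rho> i)" and C\<tau>: "C (\<tau> i)" for i
      unfolding \<rho>_def \<tau>_def by simp_all
    have \<tau>\<rho>: "\<tau> i = (\<lambda>t. \<rho> i t - \<rho> (Suc i) t)" for i
      unfolding \<tau>_def \<rho>_def tent_def ..
    have E_ramp: "E (\<rho> (Suc i)) = w (\<tau> (Suc i)) (\<tau> i) - w (\<tau> i) (\<tau> (Suc i))" for i
    proof -
      let ?u = "\<lambda>_. 1 :: real"
      have "w (\<rho> (Suc i)) (\<lambda>t. ?u t - \<rho> i t) = 0" "w (\<lambda>t. ?u t - \<rho> i t) (\<rho> (Suc i)) = 0"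
        by (auto intro!: local C_diff C\<rho> simp: \<rho>_def ramp_Suc_mult mult.commute[of "1 - _"])
      \<comment> \<open>The tent \<open>\<tau> i\<close> lives below height \<open>i + 2\<close>, where the ramp \<open>\<rho> (i + 2)\<close> starts.\<close>
      moreover have "w (\<rho> (Suc (Suc i))) (\<tau> i) = 0" "w (\<tau> i) (\<rho> (Suc (Suc i))) = 0"
        by (auto intro!: local C\<tau> C\<rho> simp: \<rho>_def \<tau>_def tent_ramp_mult mult.commute[of "ramp _ _"]
          simp del: mult_eq_0_iff)
      ultimately show ?thesis
        by (simp add: E_def diff_left diff_right C\<rho> \<tau>\<rho> C_diff)
    qed
    have diagonal: "cmod (\<Sum>j<2 * n. w (\<tau> (3 * j + q)) (\<tau> (3 * j + r))) \<le> K"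
      if "q = Suc r \<or> r = Suc q" for q r
    proof -
      have off: "w (\<tau> (3 * j + q)) (\<tau> (3 * i + r)) = 0" if "i \<noteq> j" for i j
      proof (rule local)
        fix t
        have "Suc (3 * j + q) < 3 * i + r \<or> Suc (3 * i + r) < 3 * j + q"
          using that \<open>q = Suc r \<or> r = Suc q\<close> by presburger
        then show "\<tau> (3 * j + q) t * \<tau> (3 * i + r) t = 0"
          unfolding \<tau>_def using tent_mult mult.commute by metis
      qed (rule C\<tau>)+
      have "w (\<lambda>t. \<Sum>j<2 * n. \<tau> (3 * j + q) t) (\<lambda>t. \<Sum>j<2 * n. \<tau> (3 * j + r) t) =
          (\<Sum>j<2 * n. \<Sum>i<2 * n. w (\<tau> (3 * j + q)) (\<tau> (3 * i + r)))"
        by (simp add: sum_left sum_right C\<tau> C_sum)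
      also have "\<dots> = (\<Sum>j<2 * n. \<Sum>i<2 * n. if i = j then w (\<tau> (3 * j + q)) (\<tau> (3 * j + r)) else 0)"
        by (intro sum.cong) (auto simp: off)
      also have "\<dots> = (\<Sum>j<2 * n. w (\<tau> (3 * j + q)) (\<tau> (3 * j + r)))"
        by simp
      finally show ?thesis
        using bound[of "\<lambda>t. \<Sum>j<2 * n. \<tau> (3 * j + q) t" "\<lambda>t. \<Sum>j<2 * n. \<tau> (3 * j + r) t"]
        by (simp add: C_sum C\<tau>) (simp add: \<tau>_def sum_tent_le_1)
    qed
    have eq: "real (3 * n) * t + real (3 * n) = (\<Sum>i<6 * n. \<rho> (Suc i) t)" if "\<bar>t\<bar> \<le> 1" for t
    proof -
      have "0 \<le> real (3 * n) * (t + 1)" "real (3 * n) * (t + 1) \<le> real (3 * n) * 2"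
        using that by (auto simp del: of_nat_mult intro!: mult_left_mono)
      then have "(\<Sum>i<Suc (6 * n). \<rho> i t) = 1 + real (3 * n) * (t + 1)"
        unfolding \<rho>_def by (intro sum_ramp) auto
      moreover have "\<rho> 0 t = 1"
        using \<open>0 \<le> real (3 * n) * (t + 1)\<close> by (simp add: \<rho>_def ramp_def)
      ultimately show ?thesis
        by (subst (asm) sum.lessThan_Suc_shift) (simp add: algebra_simps)
    qed
    have "C (\<lambda>t. real (3 * n) * t + real (3 * n))"
      unfolding C_def by (intro continuous_intros)
    then have "E (\<lambda>t. real (3 * n) * t + real (3 * n)) = E (\<lambda>t. \<Sum>i<6 * n. \<rho> (Suc i) t)"
      unfolding E_def
      by (intro arg_cong2[of _ _ _ _ "(-)"] cong_left cong_right C_sum C\<rho> C_const eq)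
    also have "\<dots> = (\<Sum>i<3 * (2 * n). E (\<rho> (Suc i)))"
      by (simp add: E_def sum_left sum_right C\<rho> sum_subtractf)
    also have "\<dots> = (\<Sum>r<3. (\<Sum>j<2 * n. w (\<tau> (3 * j + Suc r)) (\<tau> (3 * j + r))) -
        (\<Sum>j<2 * n. w (\<tau> (3 * j + r)) (\<tau> (3 * j + Suc r))))"
      unfolding sum_lessThan_3_mult E_ramp by (simp add: sum_subtractf)
    also have "cmod \<dots> \<le> (\<Sum>r<(3::nat). K + K)"
      by (intro sum_norm_le order_trans[OF norm_triangle_ineq4] add_mono diagonal) auto
    finally have "cmod (E (\<lambda>t. real (3 * n) * t + real (3 * n))) \<le> 6 * K"
      by simp
    moreover have "E (\<lambda>t. real (3 * n) * t + real (3 * n)) = of_real (real (3 * n)) * E (\<lambda>t. t)"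
      using scale_left[of "\<lambda>t. t" "\<lambda>_. 1" "real (3 * n)"]
        scale_right[of "\<lambda>t. t" "\<lambda>_. 1" "real (3 * n)"]
        const[of "real (3 * n)"]
        add_left[of "\<lambda>t. real (3 * n) * t" "\<lambda>_. real (3 * n)" "\<lambda>_. 1"]
        add_right[of "\<lambda>t. real (3 * n) * t" "\<lambda>_. real (3 * n)" "\<lambda>_. 1"]
      by (simp add: E_def C_def continuous_intros right_diff_distrib)
    ultimately show ?thesis
      by (simp add: norm_mult)
  qed
  have "E (\<lambda>t. t) = 0"
  proof (rule ccontr)
    assume "E (\<lambda>t. t) \<noteq> 0"
    then obtain n :: nat where "6 * K < real n * cmod (E (\<lambda>t. t))"
      using reals_Archimedean3[of "cmod (E (\<lambda>t. t))"] by auto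
    also have "\<dots> \<le> real (3 * n) * cmod (E (\<lambda>t. t))"
      by (intro mult_right_mono) auto
    finally show False using E_id[of n] by simp
  qed
  then show ?thesis by (simp add: E_def)
qed


section \<open>Forms vanishing on zero products are balanced\<close>

locale local_form = commutative_cstar N for N :: "'b::{complex_star_algebra, comm_ring} \<Rightarrow> real" +
  fixes W :: "'b \<Rightarrow> 'b \<Rightarrow> complex"
  assumes bounded: "bounded_complex_bilinear N W"
    and zero_product: "x * z = 0 \<Longrightarrow> W x z = 0"
begin

lemma W_add_left: "W (x + x') y = W x y + W x' y"
  and W_add_right: "W x (y + y') = W x y + W x y'"
  and W_scaleC_left: "W (c *\<^sub>C x) y = c * W x y"
  and W_scaleC_right: "W x (c *\<^sub>C y) = c * W x y"
  using bounded unfolding bounded_complex_bilinear_def by simp_all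

lemma W_diff_left: "W (x - x') y = W x y - W x' y"
  using W_add_left[of "x - x'" x' y] by simp

lemma W_diff_right: "W x (y - y') = W x y - W x y'"
  using W_add_right[of x "y - y'" y'] by simp

lemma W_bound: obtains K where "0 \<le> K" "\<And>x y. cmod (W x y) \<le> N x * N y * K"
proof -
  obtain K where K: "\<And>x y. cmod (W x y) \<le> N x * N y * K"
    using bounded unfolding bounded_complex_bilinear_def by blast
  have "N x * N y * K \<le> N x * N y * \<bar>K\<bar>" for x y
    by (intro mult_left_mono) auto
  then show ?thesis using K by (intro that[of "\<bar>K\<bar>"]) (simp, blast intro: order_trans)
qed

text \<open>The continuous calculus of \<open>h\<close> turns \<open>W\<close> into a local form on \<open>C[-1, 1]\<close>; the identity function acts as
  multiplication by \<open>h\<close>, and the constant 1 as the identity operator.\<close>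

lemma balanced_cosine:
  assumes h: "cosine_partner h c"
  shows "W (h * x) z = W x (h * z)"
proof -
  obtain K where K: "0 \<le> K" "\<And>x y. cmod (W x y) \<le> N x * N y * K"
    using W_bound by blast
  define w where "w f g = W (cont_act h f x) (cont_act h g z)" for f g
  have "w (\<lambda>t. t) (\<lambda>_. 1) = w (\<lambda>_. 1) (\<lambda>t. t)"
  proof (rule local_bilinear_form_balanced)
    fix f g :: "real \<Rightarrow> real"
    assume f: "continuous_on {-1..1} f" and g: "continuous_on {-1..1} g"
      and f1: "\<And>t. \<bar>t\<bar> \<le> 1 \<Longrightarrow> \<bar>f t\<bar> \<le> 1" and g1: "\<And>t. \<bar>t\<bar> \<le> 1 \<Longrightarrow> \<bar>g t\<bar> \<le> 1"
    have "N (cont_act h f x) * N (cont_act h g z) * K \<le> N x * N z * K"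
      using N_cont_act_le[OF h f f1, of x] N_cont_act_le[OF h g g1, of z] K(1)
      by (intro mult_right_mono mult_mono) auto
    then show "cmod (w f g) \<le> N x * N z * K"
      unfolding w_def using K(2) order_trans by blast
  qed (simp_all add: w_def cont_act_add[OF h] cont_act_scale[OF h] W_add_left W_add_right
      W_scaleC_left W_scaleC_right zero_product cont_act_mult_eq_0[OF h])
  moreover have "cont_act h (\<lambda>t. t) y = h * y" for y
    by (subst cont_act_poly[OF h, of _ "[:0, 1:]"]) (auto simp: scaleC_one intro: continuous_intros)
  moreover have "cont_act h (\<lambda>_. 1) y = y" for y
    by (subst cont_act_poly[OF h, of _ "[:1:]"]) (auto simp: scaleC_one intro: continuous_intros)
  ultimately show ?thesis by (simp add: w_def)
qed

lemma balanced_self_adjoint: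
  assumes h: "star h = h"
  shows "W (h * x) z = W x (h * z)"
proof -
  obtain r c where r: "0 < r" "cosine_partner (of_real r *\<^sub>C h) c"
    using cosine_partner_scaled[OF h] .
  from balanced_cosine[OF r(2), of x z] have "of_real r * W (h * x) z = of_real r * W x (h * z)"
    by (simp add: mult_scaleC_left W_scaleC_left W_scaleC_right)
  then show ?thesis using r(1) by simp
qed

text \<open>Every element is a combination of the self-adjoint elements \<open>y + y*\<close> and \<open>\<i>(y - y*)\<close>.\<close>

lemma balanced: "W (y * x) z = W x (y * z)"
proof -
  define a b where "a = y + star y" and "b = \<i> *\<^sub>C (y - star y)"
  have "star a = a" "star b = b"
    by (simp_all add: a_def b_def cstar_simps scaleC_simps)
  moreover have y: "y = (1/2) *\<^sub>C a - (\<i>/2) *\<^sub>C b"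
    by (simp add: a_def b_def scaleC_simps scaleC_half)
  ultimately show ?thesis
    unfolding y using balanced_self_adjoint
    by (simp add: left_diff_distrib W_diff_left W_diff_right mult_scaleC_left W_scaleC_left
        W_scaleC_right)
qed

end


section \<open>Approximate units and the representing functional\<close>

text \<open>The first factor is small near 0 and the second one away from 0.\<close>

lemma abs_mult_power_uniformly_small:
  fixes d :: real
  assumes "0 < d"
  obtains n where "\<And>t. \<bar>t\<bar> \<le> 1 \<Longrightarrow> \<bar>t\<bar> * (1 - t\<^sup>2) ^ n \<le> d"
proof (cases "d < 1")
  case True
  have d2: "0 \<le> 1 - d\<^sup>2" "1 - d\<^sup>2 < 1"
    using assms True by (simp_all add: power_le_one)
  obtain n where n: "(1 - d\<^sup>2) ^ n < d"
    using real_arch_pow_inv[OF assms d2(2)] by blast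
  have "\<bar>t\<bar> * (1 - t\<^sup>2) ^ n \<le> d" if t: "\<bar>t\<bar> \<le> 1" for t
  proof -
    have t2: "0 \<le> 1 - t\<^sup>2" using t by (simp add: abs_square_le_1)
    show ?thesis
    proof (cases "\<bar>t\<bar> \<le> d")
      case True
      then show ?thesis
        using t2 mult_mono[of "\<bar>t\<bar>" d "(1 - t\<^sup>2) ^ n" 1] assms by (simp add: power_le_one)
    next
      case False
      then have "d\<^sup>2 \<le> \<bar>t\<bar>\<^sup>2" using assms by (intro power_mono) auto
      then have "(1 - t\<^sup>2) ^ n \<le> (1 - d\<^sup>2) ^ n" using t2 by (intro power_mono) auto
      then show ?thesis
        using t t2 n mult_mono[of "\<bar>t\<bar>" 1 "(1 - t\<^sup>2) ^ n" d] by simp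
    qed
  qed
  then show ?thesis by (rule that)
next
  case False
  show ?thesis by (rule that[of 0]) (use False in auto)
qed

context commutative_cstar
begin

text \<open>For \<open>h\<close> proportional to \<open>z* z\<close>, take \<open>u\<close> with \<open>1 - u = (1 - h\<^sup>2)\<^sup>n\<close>. This is a power of
  the contraction \<open>(1 - c)\<^sup>2\<close>, and since \<open>t (1 - t\<^sup>2)\<^sup>n\<close> is uniformly small on \<open>[-1, 1]\<close>,
  \<open>(1 - u) h\<close> is small; hence so is \<open>(1 - u) z\<close> by the C*-identity.\<close>

lemma approximate_unit_single:
  assumes "0 < e"
  obtains u where "\<And>y. N (y - u * y) \<le> N y" "N (z - u * z) < e"
proof -
  define s where "s = star z * z"
  have s: "star s = s" by (simp add: s_def cstar_simps)
  obtain r c where r: "0 < r" and c: "cosine_partner (of_real r *\<^sub>C s) c"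
    using cosine_partner_scaled[OF s] .
  define h where "h = of_real r *\<^sub>C s"
  have h: "star h = h" "cosine_partner h c" using c by (simp_all add: h_def cosine_partner_def)
  have hc: "h * h = c + c - c * c" using h by (simp add: cosine_partner_def)
  \<comment> \<open>The norm of \<open>(1 - u) z\<close> will be at most \<open>sqrt (d / r)\<close>.\<close>
  define d where "d = r * e\<^sup>2 / 2"
  have d: "0 < d" using r assms by (simp add: d_def)
  obtain n where n: "\<And>t. \<bar>t\<bar> \<le> 1 \<Longrightarrow> \<bar>t\<bar> * (1 - t\<^sup>2) ^ n \<le> d"
    using abs_mult_power_uniformly_small[OF d] by blast
  define p :: "complex poly" where "p = [:1, 0, -1:] ^ n"
  have step: "poly_act h [:1, 0, -1:] y = y - h * (h * y)" for y
    by (simp add: scaleC_one)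
  have contr: "N (poly_act h [:1, 0, -1:] y) \<le> N y" for y
  proof -
    have "poly_act h [:1, 0, -1:] y = (y - c * y) - c * (y - c * y)"
      unfolding step mult.assoc[symmetric] hc by (simp add: algebra_simps)
    then show ?thesis
      using order_trans[OF cosine_contraction[OF h(2)] cosine_contraction[OF h(2)]] by simp
  qed
  have "\<exists>u. \<forall>y. poly_act h ([:1, 0, -1:] ^ n) y = y - u * y" for n
  proof (induction n)
    case 0
    show ?case by (rule exI[of _ 0]) (simp add: scaleC_one flip: pCons_one)
  next
    case (Suc n)
    then obtain u where u: "\<And>y. poly_act h ([:1, 0, -1:] ^ n) y = y - u * y" by blast
    show ?case
      unfolding power_Suc poly_act_mult u step
      by (rule exI[of _ "u + h * h - h * h * u"]) (simp add: algebra_simps)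
  qed
  then obtain u where u: "\<And>y. poly_act h p y = y - u * y" unfolding p_def by blast
  have contr_p: "N (poly_act h p y) \<le> N y" for y
    unfolding p_def
  proof (induction n)
    case 0
    show ?case by (simp add: scaleC_one flip: pCons_one)
  next
    case (Suc n)
    then show ?case unfolding power_Suc poly_act_mult using contr order_trans by blast
  qed
  have "map_poly cnj p = p"
  proof -
    have "poly p z = (1 - z\<^sup>2) ^ n" for z by (simp add: p_def power2_eq_square)
    then have "poly (map_poly cnj p) z = poly p z" for z by simp
    then show ?thesis using poly_eq_poly_eq_iff by blast
  qed
  note star_p = star_poly_act[of _ p, unfolded this]
  have Nh: "N (poly_act h p h) \<le> d"
  proof (cases "poly_act h p h = 0")
    case False
    then have pos: "0 < N (poly_act h p h)" by (simp add: less_le)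
    have "star (poly_act h p h) * poly_act h p h = poly_act h (pCons 0 p) (poly_act h p h)"
    proof -
      have "poly_act h p h * poly_act h p h = poly_act h p (poly_act h p h * h)"
        using poly_act_mult_left[of h p h "poly_act h p h"] by (simp add: mult.commute)
      also have "\<dots> = poly_act h p (poly_act h p h) * h"
        by (rule poly_act_mult_left[symmetric])
      finally show ?thesis
        by (simp add: star_p[OF h(1)] h(1) mult.commute[of h])
    qed
    moreover have "N (poly_act h (pCons 0 p) (poly_act h p h)) \<le> d * N (poly_act h p h)"
    proof (rule N_poly_act_le_sup[OF h(2)])
      fix t :: real assume t: "\<bar>t\<bar> \<le> 1"
      then have "0 \<le> 1 - t\<^sup>2" by (simp add: abs_square_le_1)
      moreover have "poly (pCons 0 p) (of_real t) = of_real ((1 - t\<^sup>2) ^ n * t)"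
        by (simp add: p_def power2_eq_square)
      ultimately have "cmod (poly (pCons 0 p) (of_real t)) = \<bar>t\<bar> * (1 - t\<^sup>2) ^ n"
        by (simp only: norm_of_real abs_mult abs_of_nonneg zero_le_power) (simp add: mult.commute)
      then show "cmod (poly (pCons 0 p) (of_real t)) \<le> d" using n[OF t] by simp
    qed
    ultimately have "N (poly_act h p h) * N (poly_act h p h) \<le> d * N (poly_act h p h)"
      using N_star_mult[of "poly_act h p h"] by (simp add: power2_eq_square)
    then show ?thesis using pos by simp
  qed (use d in simp)
  have "star (poly_act h p z) * poly_act h p z = poly_act h p (poly_act h p s)"
    by (simp add: star_p[OF h(1)] poly_act_mult_left mult.commute[of "star z"])
      (simp add: poly_act_mult_left s_def mult.commute)
  then have "(N (poly_act h p z))\<^sup>2 \<le> N (poly_act h p s)"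
    using contr_p[of "poly_act h p s"] by (simp flip: N_star_mult)
  also have "\<dots> = N (poly_act h p h) / r"
  proof -
    have "poly_act h p h = of_real r *\<^sub>C poly_act h p s"
      using complex_linear_poly_act[of h p] unfolding complex_linear_def
      by (subst (2) h_def) simp
    then show ?thesis using r by simp
  qed
  also have "\<dots> \<le> d / r" using Nh r by (intro divide_right_mono) auto
  also have "\<dots> < e\<^sup>2" using r assms by (simp add: d_def)
  finally have "N (poly_act h p z) < e" using assms by (simp add: power2_less_imp_less)
  then show ?thesis using that contr_p unfolding u by blast
qed

text \<open>Approximate units for two sets are merged by \<open>1 - w = (1 - u) (1 - v)\<close>; each factor keeps what the
  other one has made small.\<close>

lemma approximate_unit_finite:
  assumes "finite S" "0 < e"
  shows "\<exists>u. (\<forall>y. N (y - u * y) \<le> N y) \<and> (\<forall>z\<in>S. N (z - u * z) < e)"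
  using assms(1)
proof (induction S rule: finite_induct)
  case empty
  show ?case by (rule exI[of _ 0]) simp
next
  case (insert z S)
  then obtain u where u: "\<And>y. N (y - u * y) \<le> N y" "\<And>x. x \<in> S \<Longrightarrow> N (x - u * x) < e" by blast
  obtain v where v: "\<And>y. N (y - v * y) \<le> N y" "N (z - v * z) < e"
    using approximate_unit_single[OF assms(2)] by blast
  let ?w = "u + v - u * v"
  have w1: "y - ?w * y = (y - v * y) - u * (y - v * y)"
    and w2: "y - ?w * y = (y - u * y) - v * (y - u * y)" for y
    by (simp_all add: algebra_simps)
  show ?case
  proof (intro exI[of _ ?w] conjI allI ballI)
    show "N (y - ?w * y) \<le> N y" for y
      unfolding w1 using u(1) v(1) order_trans by blast
    show "N (x - ?w * x) < e" if "x \<in> insert z S" for x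
    proof (cases "x = z")
      case True
      then show ?thesis unfolding w1 using u(1)[of "z - v * z"] v(2) by simp
    next
      case False
      then show ?thesis unfolding w2 using v(1)[of "x - u * x"] u(2)[of x] that by simp
    qed
  qed
qed

lemma N_le_2_if_contraction:
  assumes "\<And>y. N (y - u * y) \<le> N y"
  shows "N u \<le> 2"
proof (cases "u = 0")
  case False
  then have u: "0 < N u" by (simp add: less_le)
  have "N (star u * u) \<le> N (star u) + N (star u - u * star u)"
    using N_triangle_diff[of "star u" "star u - u * star u"] by (simp add: mult.commute)
  also have "\<dots> \<le> 2 * N u" using assms[of "star u"] by simp
  finally have "N u * N u \<le> 2 * N u" by (simp add: N_star_mult power2_eq_square)
  then show ?thesis using u by simp
qed simp

text \<open>The bound 2 is what \<open>N_le_2_if_contraction\<close> yields.\<close>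

definition approx_units :: "'b set \<Rightarrow> real \<Rightarrow> 'b set" where
  "approx_units S e = {u. N u \<le> 2 \<and> (\<forall>z\<in>S. N (z - u * z) < e)}"

text \<open>The filter of approximate units. A sequence would not do, because there need not be a countable
  approximate unit.\<close>

definition at_unit :: "'b filter" where
  "at_unit = (INF (S, e) \<in> {(S, e). finite S \<and> 0 < e}. principal (approx_units S e))"

lemma eventually_at_unit:
  "eventually P at_unit \<longleftrightarrow> (\<exists>S e. finite S \<and> 0 < e \<and> (\<forall>u\<in>approx_units S e. P u))"
proof -
  have "eventually P at_unit \<longleftrightarrow>
      (\<exists>b\<in>{(S, e). finite S \<and> 0 < e}. eventually P (case b of (S, e) \<Rightarrow> principal (approx_units S e)))"
    unfolding at_unit_def
  proof (rule eventually_INF_base)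
    show "{(S::'b set, e::real). finite S \<and> 0 < e} \<noteq> {}"
      using finite.emptyI zero_less_one by blast
    fix a b :: "'b set \<times> real"
    assume ab: "a \<in> {(S, e). finite S \<and> 0 < e}" "b \<in> {(S, e). finite S \<and> 0 < e}"
    show "\<exists>x\<in>{(S, e). finite S \<and> 0 < e}. (case x of (S, e) \<Rightarrow> principal (approx_units S e)) \<le>
        inf (case a of (S, e) \<Rightarrow> principal (approx_units S e))
          (case b of (S, e) \<Rightarrow> principal (approx_units S e))"
      by (rule bexI[of _ "(fst a \<union> fst b, min (snd a) (snd b))"])
        (use ab in \<open>auto simp: approx_units_def split: prod.splits\<close>)
  qed
  then show ?thesis by (auto simp: eventually_principal)
qed

lemma at_unit_neq_bot: "at_unit \<noteq> bot"
proof -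
  have "approx_units S e \<noteq> {}" if "finite S" "0 < e" for S e
    using approximate_unit_finite[OF that] N_le_2_if_contraction
    unfolding approx_units_def by blast
  then show ?thesis
    unfolding trivial_limit_def eventually_at_unit by auto
qed

lemma eventually_at_unit_bounded: "\<forall>\<^sub>F u in at_unit. N u \<le> 2"
  unfolding eventually_at_unit
  by (rule exI[of _ "{}"], rule exI[of _ 1]) (simp add: approx_units_def)

lemma eventually_at_unit_close: "0 < e \<Longrightarrow> \<forall>\<^sub>F u in at_unit. N (z - u * z) < e"
  unfolding eventually_at_unit
  by (rule exI[of _ "{z}"], rule exI[of _ e]) (simp add: approx_units_def)

lemma tendsto_at_unit: "((\<lambda>u. N (z - u * z)) \<longlongrightarrow> 0) at_unit"
  by (rule tendstoI) (use eventually_at_unit_close in simp)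

end

context local_form
begin

text \<open>On a product \<open>v * z\<close> the values \<open>W u (v * z) = W (u * v) z\<close> converge because \<open>u * v\<close> does, and
  every \<open>z\<close> is a limit of such products while the functionals \<open>W u\<close> are uniformly bounded.\<close>

lemma convergent_at_unit: "\<exists>l. ((\<lambda>u. W u z) \<longlongrightarrow> l) at_unit"
proof -
  obtain K where K: "0 \<le> K" "\<And>x y. cmod (W x y) \<le> N x * N y * K"
    using W_bound by blast
  have "cauchy_filter (filtermap (\<lambda>u. W u z) at_unit)"
    unfolding cauchy_filter_metric_filtermap
  proof (intro allI impI)
    fix e :: real assume e: "0 < e"
    have pos: "0 < 8 * (K + 1)" "0 < 4 * ((K + 1) * (N z + 1))"
      using K(1) N_nonneg[of z] by (simp_all add: add_nonneg_pos)
    have "\<forall>\<^sub>F v in at_unit. N (z - v * z) < e / (8 * (K + 1))"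
      using e pos by (intro eventually_at_unit_close) simp
    then obtain v where v: "N (z - v * z) < e / (8 * (K + 1))"
      using eventually_happens'[OF at_unit_neq_bot] by blast
    let ?P = "\<lambda>u. N u \<le> 2 \<and> N (v - u * v) < e / (4 * ((K + 1) * (N z + 1)))"
    have "eventually ?P at_unit"
      using e pos by (intro eventually_conj eventually_at_unit_bounded eventually_at_unit_close) simp
    moreover have close: "cmod (W u z - W v z) < e / 2" if u: "?P u" for u
    proof -
      have "W u z - W v z = W u (z - v * z) - W (v - u * v) z"
        using balanced[of v u z] by (simp add: W_diff_left W_diff_right mult.commute)
      then have "cmod (W u z - W v z) \<le> cmod (W u (z - v * z)) + cmod (W (v - u * v) z)"
        by (simp add: norm_triangle_ineq4)
      also have "\<dots> \<le> N u * N (z - v * z) * K + N (v - u * v) * N z * K"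
        by (intro add_mono K)
      also have "N u * N (z - v * z) * K \<le> 2 * (e / (8 * (K + 1))) * (K + 1)"
        using u v K(1) e by (intro mult_mono) auto
      also have "2 * (e / (8 * (K + 1))) * (K + 1) = e / 4"
        using pos by (simp add: field_simps)
      also have "N (v - u * v) * N z * K \<le> N (v - u * v) * ((K + 1) * (N z + 1))"
        unfolding mult.assoc using K(1)
        by (intro mult_left_mono) (auto simp: algebra_simps)
      also have "\<dots> < e / (4 * ((K + 1) * (N z + 1))) * ((K + 1) * (N z + 1))"
        using u pos by (intro mult_strict_right_mono) auto
      also have "\<dots> = e / 4"
        using pos by (simp add: field_simps)
      finally show ?thesis by simp
    qed
    moreover have "dist (W u z) (W u' z) < e" if "?P u \<and> ?P u'" for u u'
      using close[of u] close[of u'] that dist_triangle_half_l[of "W u z" "W v z" e "W u' z"]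
      by (simp add: dist_norm)
    ultimately show "\<exists>P. eventually P at_unit \<and> (\<forall>x y. P x \<and> P y \<longrightarrow> dist (W x z) (W y z) < e)"
      by blast
  qed
  then have "\<exists>l. filtermap (\<lambda>u. W u z) at_unit \<le> nhds l"
    by (intro cauchy_filter_complete_converges[of _ UNIV])
      (auto simp: complete_UNIV filtermap_bot_iff at_unit_neq_bot)
  then show ?thesis by (simp add: filterlim_def)
qed

text \<open>The value \<open>\<phi> z\<close> is the limit of \<open>W u z\<close> along the approximate units; \<open>W u (x * y) = W (u * x) y\<close>
  tends to \<open>W x y\<close>.\<close>

theorem representation:
  obtains \<phi> where
    "\<And>x y. \<phi> (x + y) = \<phi> x + \<phi> y" "\<And>c x. \<phi> (c *\<^sub>C x) = c * \<phi> x"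
    "\<exists>K. \<forall>x. cmod (\<phi> x) \<le> K * N x" "\<And>x y. W x y = \<phi> (x * y)"
proof -
  obtain \<phi> where \<phi>: "\<And>z. ((\<lambda>u. W u z) \<longlongrightarrow> \<phi> z) at_unit"
    using convergent_at_unit by metis
  obtain K where K: "0 \<le> K" "\<And>x y. cmod (W x y) \<le> N x * N y * K"
    using W_bound by blast
  note unique = tendsto_unique[OF at_unit_neq_bot]
  show ?thesis
  proof
    show "\<phi> (x + y) = \<phi> x + \<phi> y" for x y
      using unique[OF \<phi>[of "x + y"]] tendsto_add[OF \<phi>[of x] \<phi>[of y]] by (simp add: W_add_right)
    show "\<phi> (c *\<^sub>C x) = c * \<phi> x" for c x
      using unique[OF \<phi>[of "c *\<^sub>C x"]] tendsto_mult_left[OF \<phi>[of x], of c] by (simp add: W_scaleC_right)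
    have "cmod (\<phi> x) \<le> 2 * K * N x" for x
    proof (rule tendsto_upperbound[OF tendsto_norm[OF \<phi>] _ at_unit_neq_bot])
      show "\<forall>\<^sub>F u in at_unit. cmod (W u x) \<le> 2 * K * N x"
        using eventually_at_unit_bounded
      proof eventually_elim
        case (elim u)
        then have "N u * N x * K \<le> 2 * N x * K"
          using K(1) by (intro mult_right_mono) auto
        then show ?case using K(2)[of u x] by (simp add: mult_ac)
      qed
    qed
    then show "\<exists>K. \<forall>x. cmod (\<phi> x) \<le> K * N x" by blast
    show "W x y = \<phi> (x * y)" for x y
    proof (rule unique)
      have "((\<lambda>u. W x y - W u (x * y)) \<longlongrightarrow> 0) at_unit"
      proof (rule Lim_null_comparison)
        show "((\<lambda>u. N (x - u * x) * (N y * K)) \<longlongrightarrow> 0) at_unit"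
          by (rule tendsto_mult_left_zero[OF tendsto_at_unit])
        have "W x y - W u (x * y) = W (x - u * x) y" for u
          using balanced[of x u y] by (simp add: W_diff_left mult.commute)
        then show "\<forall>\<^sub>F u in at_unit. norm (W x y - W u (x * y)) \<le> N (x - u * x) * (N y * K)"
          using K(2) by (simp add: mult.assoc)
      qed
      from tendsto_diff[OF tendsto_const[of "W x y"] this]
      show "((\<lambda>u. W u (x * y)) \<longlongrightarrow> W x y) at_unit" by simp
    qed (rule \<phi>)
  qed
qed

end


section \<open>The complexification of a commutative real C*-algebra\<close>

instance complexification :: ("{real_banach_star_algebra, comm_ring}") comm_ring
proof
  fix a b c :: "'a complexification"
  show "a * b = b * a"
    by (simp add: times_complexification_def mult.commute add.commute)
  show "(a + b) * c = a * c + b * c"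
    by (rule distrib_right)
qed

definition complexification_conj ::
    "'a::real_banach_star_algebra complexification \<Rightarrow> 'a complexification" where
  "complexification_conj x = Complexification (re_part x) (- im_part x)"

lemma star_minus: "star (- a) = - star (a::'a::real_banach_star_algebra)"
  using star_scaleR[of "-1" a] by simp

lemma complexification_conj_add:
    "complexification_conj (x + y) = complexification_conj x + complexification_conj y"
  and complexification_conj_diff:
    "complexification_conj (x - y) = complexification_conj x - complexification_conj y"
  and complexification_conj_mult:
    "complexification_conj (x * y) = complexification_conj x * complexification_conj y"
  and complexification_conj_star:
    "complexification_conj (star x) = star (complexification_conj x)"
  and complexification_conj_scaleC:
    "complexification_conj (c *\<^sub>C x) = cnj c *\<^sub>C complexification_conj x"
  by (simp_all add: complexification_conj_def plus_complexification_def minus_complexification_def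
      times_complexification_def star_complexification_def scaleC_complexification_def star_minus)

text \<open>For self-adjoint \<open>h\<close> of norm below 1 with cosine partner \<open>p\<close>, conjugation preserves the relation
  between \<open>h\<close> and \<open>p\<close>, which bounds the conjugate of \<open>h\<close> by 1. The C*-identity reduces the general
  case to \<open>x* x\<close>.\<close>

lemma N_complexification_conj_le:
  fixes N :: "'a::{real_cstar_algebra, comm_ring} complexification \<Rightarrow> real"
  assumes "complex_cstar_norm N"
  shows "N (complexification_conj x) \<le> N x"
proof -
  interpret commutative_cstar N by unfold_locales (rule assms)
  have sa: "N (complexification_conj h) \<le> N h" if h: "star h = h" for h
  proof (rule field_le_epsilon)
    fix e :: real assume e: "0 < e"
    let ?r = "1 / (N h + e)"
    have r: "0 < ?r" using e N_nonneg[of h] by (simp add: add_nonneg_pos)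
    have "N (of_real ?r *\<^sub>C h) < 1"
      using r e by (simp only: N_scaleC norm_of_real abs_of_pos) simp
    moreover have "star (of_real ?r *\<^sub>C h) = of_real ?r *\<^sub>C h"
      by (simp only: cstar_scaleC complex_cnj_complex_of_real h)
    ultimately obtain p where "cosine_partner (of_real ?r *\<^sub>C h) p"
      using cosine_partner_exists by metis
    then have "cosine_partner (complexification_conj (of_real ?r *\<^sub>C h)) (complexification_conj p)"
      unfolding cosine_partner_def
      by (metis complexification_conj_add complexification_conj_diff complexification_conj_mult
          complexification_conj_star)
    from cosine_partner_norm_le_1[OF this] have "?r * N (complexification_conj h) \<le> 1"
      using r by (simp only: complexification_conj_scaleC N_scaleC complex_cnj_complex_of_real
          norm_of_real abs_of_pos)
    then show "N (complexification_conj h) \<le> N h + e"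
      using r by (simp add: divide_simps split: if_splits)
  qed
  have "(N (complexification_conj x))\<^sup>2 = N (complexification_conj (star x * x))"
    by (simp add: complexification_conj_mult complexification_conj_star N_star_mult)
  also have "\<dots> \<le> (N x)\<^sup>2"
    using sa[of "star x * x"] by (simp add: cstar_simps N_star_mult)
  finally show ?thesis
    by (rule power2_le_imp_le) simp
qed

text \<open>The real part is the mean of \<open>x\<close> and its conjugate, and the imaginary part of \<open>x\<close> is the real part
  of \<open>-\<i> x\<close>.\<close>

lemma norm_parts_le:
  fixes N :: "'a::{real_cstar_algebra, comm_ring} complexification \<Rightarrow> real"
  assumes "complexification_norm N"
  shows "norm (re_part x) \<le> N x" "norm (im_part x) \<le> N x"
proof -
  have N: "complex_cstar_norm N" "\<And>a. N (Complexification a 0) = norm a"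
    using assms by (auto simp: complexification_norm_def)
  interpret commutative_cstar N by unfold_locales (rule N(1))
  have re: "norm (re_part y) \<le> N y" for y
  proof -
    have "Complexification (re_part y) 0 = (1/2) *\<^sub>C (y + complexification_conj y)"
      by (simp add: complexification_conj_def plus_complexification_def scaleC_complexification_def
          flip: scaleR_left_distrib scaleR_add_right)
    then have "norm (re_part y) = (1/2) * N (y + complexification_conj y)"
      by (simp flip: N(2))
    then show ?thesis
      using N_triangle[of y "complexification_conj y"] N_complexification_conj_le[OF N(1), of y] by simp
  qed
  show "norm (re_part x) \<le> N x" by (rule re)
  show "norm (im_part x) \<le> N x"
    using re[of "(- \<i>) *\<^sub>C x"] N_scaleC[of "- \<i>" x]
    by (simp add: scaleC_complexification_def del: scaleC_minus_left)
qed

text \<open>In a commutative algebra, \<open>x\<close> is orthogonal to \<open>z*\<close> exactly when \<open>x * z = 0\<close>.\<close>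

lemma local_form_if_orthogonal:
  fixes N :: "'a::{real_cstar_algebra, comm_ring} complexification \<Rightarrow> real"
  assumes "complex_cstar_norm N" "complex_orthogonal_form N W"
  shows "local_form N W"
proof
  show "complex_cstar_norm N" by fact
  show "bounded_complex_bilinear N W" using assms(2) by (simp add: complex_orthogonal_form_def)
  show "W x z = 0" if "x * z = 0" for x z
  proof -
    have "orthogonal_elements x (star z)"
      using that by (simp add: orthogonal_elements_def cstar_star mult.commute)
    then show ?thesis
      using assms(2) cstar_star[of z] unfolding complex_orthogonal_form_def by metis
  qed
qed

lemma functional_of_orthogonal_extension:
  fixes V :: "'a::{real_cstar_algebra, comm_ring} \<Rightarrow> 'a \<Rightarrow> real"
    and N :: "'a complexification \<Rightarrow> real"
  assumes V: "bounded_bilinear V"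
    and N: "complexification_norm N"
    and W: "complex_orthogonal_form N (bilinear_extension V)"
  shows "\<exists>\<phi>\<^sub>1. bounded_linear \<phi>\<^sub>1 \<and> (\<forall>x y. V x y = \<phi>\<^sub>1 (x * y))"
proof -
  have N': "complex_cstar_norm N" "\<And>a. N (Complexification a 0) = norm a"
    using N by (auto simp: complexification_norm_def)
  interpret local_form N "bilinear_extension V"
    by (rule local_form_if_orthogonal[OF N'(1) W])
  obtain \<phi> K where add: "\<And>x y. \<phi> (x + y) = \<phi> x + \<phi> y"
    and scale: "\<And>c x. \<phi> (c *\<^sub>C x) = c * \<phi> x"
    and K: "\<And>x. cmod (\<phi> x) \<le> K * N x"
    and rep: "\<And>x y. bilinear_extension V x y = \<phi> (x * y)"
    using representation by metis
  interpret V: bounded_bilinear V by fact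
  let ?\<phi> = "\<lambda>a. Re (\<phi> (Complexification a 0))"
  have "bounded_linear ?\<phi>"
  proof (rule bounded_linear_intro)
    show "?\<phi> (a + b) = ?\<phi> a + ?\<phi> b" for a b
      using add[of "Complexification a 0" "Complexification b 0"] by (simp add: plus_complexification_def)
    show "?\<phi> (r *\<^sub>R a) = r *\<^sub>R ?\<phi> a" for r a
      using scale[of "of_real r" "Complexification a 0"] by (simp add: scaleC_complexification_def)
    show "norm (?\<phi> a) \<le> norm a * K" for a
      using K[of "Complexification a 0"] abs_Re_le_cmod[of "\<phi> (Complexification a 0)"]
      by (simp add: N'(2) mult.commute)
  qed
  moreover have "V x y = ?\<phi> (x * y)" for x y
    using arg_cong[OF rep[of "Complexification x 0" "Complexification y 0"], of Re]
    by (simp add: bilinear_extension_def times_complexification_def V.zero_left)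
  ultimately show ?thesis by (intro exI[of _ ?\<phi>]) blast
qed

lemma orthogonal_extension_of_functional:
  fixes V :: "'a::{real_cstar_algebra, comm_ring} \<Rightarrow> 'a \<Rightarrow> real"
    and N :: "'a complexification \<Rightarrow> real"
  assumes N: "complexification_norm N"
    and \<phi>: "bounded_linear \<phi>" and V: "\<And>x y. V x y = \<phi> (x * y)"
  shows "complex_orthogonal_form N (bilinear_extension V)"
proof -
  have N': "complex_cstar_norm N" using N by (simp add: complexification_norm_def)
  interpret commutative_cstar N by unfold_locales (rule N')
  interpret \<phi>: bounded_linear \<phi> by fact
  define \<Phi> where "\<Phi> z = Complex (\<phi> (re_part z)) (\<phi> (im_part z))" for z
  have rep: "bilinear_extension V x y = \<Phi> (x * y)" for x y
    by (simp add: bilinear_extension_def \<Phi>_def V times_complexification_def \<phi>.add \<phi>.diff)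
  have add: "\<Phi> (x + y) = \<Phi> x + \<Phi> y" for x y
    by (simp add: \<Phi>_def plus_complexification_def \<phi>.add complex_eq_iff)
  have scale: "\<Phi> (c *\<^sub>C x) = c * \<Phi> x" for c x
    by (simp add: \<Phi>_def scaleC_complexification_def \<phi>.add \<phi>.diff \<phi>.scale complex_eq_iff)
  have zero: "\<Phi> 0 = 0"
    using scale[of 0 0] by simp
  obtain K where K: "0 < K" "\<And>a. norm (\<phi> a) \<le> norm a * K"
    using \<phi>.pos_bounded by blast
  have "cmod (\<Phi> (x * y)) \<le> N x * N y * (2 * K)" for x y
  proof -
    have "cmod (\<Phi> (x * y)) \<le> \<bar>\<phi> (re_part (x * y))\<bar> + \<bar>\<phi> (im_part (x * y))\<bar>"
      using cmod_le[of "\<Phi> (x * y)"] by (simp add: \<Phi>_def)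
    also have "\<dots> \<le> N (x * y) * K + N (x * y) * K"
      using K norm_parts_le[OF N, of "x * y"]
      by (intro add_mono order_trans[OF K(2)[unfolded real_norm_def]] mult_right_mono) auto
    also have "\<dots> \<le> N x * N y * (2 * K)"
      using mult_right_mono[OF N_mult[of x y], of "2 * K"] K(1) by simp
    finally show ?thesis .
  qed
  then have "\<exists>K. \<forall>x y. cmod (\<Phi> (x * y)) \<le> N x * N y * K" by blast
  then show ?thesis
    unfolding complex_orthogonal_form_def bounded_complex_bilinear_def rep orthogonal_elements_def
    by (auto simp: distrib_left distrib_right add scale mult_scaleC_left mult_scaleC_right zero)
qed

theorem corollary2p8:
  fixes V :: "'a::{real_cstar_algebra, comm_ring} \<Rightarrow> 'a \<Rightarrow> real"
    and N :: "'a complexification \<Rightarrow> real"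
  assumes "real_orthogonal_form V"
    and "complexification_norm N"
  shows "complex_orthogonal_form N (bilinear_extension V) \<longleftrightarrow>
    (\<exists>\<phi>\<^sub>1::'a \<Rightarrow> real. bounded_linear \<phi>\<^sub>1 \<and> (\<forall>x y. V x y = \<phi>\<^sub>1 (x * y)))"
proof
  show "\<exists>\<phi>\<^sub>1. bounded_linear \<phi>\<^sub>1 \<and> (\<forall>x y. V x y = \<phi>\<^sub>1 (x * y))"
    if "complex_orthogonal_form N (bilinear_extension V)"
    using functional_of_orthogonal_extension[OF _ assms(2) that] assms(1)
    by (simp add: real_orthogonal_form_def)
  show "complex_orthogonal_form N (bilinear_extension V)"
    if "\<exists>\<phi>\<^sub>1. bounded_linear \<phi>\<^sub>1 \<and> (\<forall>x y. V x y = \<phi>\<^sub>1 (x * y))"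
    using that orthogonal_extension_of_functional[OF assms(2)] by blast
qed

end
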